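(* Let $C$ be a chord diagram with $k$ chords. The degree of the polynomial $U(C)$ in $n$ equals $k+2$ if and only if $C$ is a $d$-diagram. Moreover, the coefficient of $n^{k+2}$ in $U(C)$ equals the number of splittings of the set of chords of $C$ into two families (a first one and a second one, i.e. ordered splittings, where a family may be empty) each consisting of pairwise nonintersecting chords.
   Context: A chord diagram of degree $k$ is an oriented circle with $2k$ distinct points on it joined in pairs by $k$ chords, considered up to orientation-preserving homeomorphism (isotopy) of the circle; combinatorially, a perfect matching of $2k$ cyclically ordered points. Two chords $\{a,b\}$, $\{c,d\}$ intersect if their endpoints alternate along the circle. A $d$-diagram is a chord diagram whose set of chords can be split into two (possibly empty) families of pairwise nonintersecting chords. The function $U$: number the endpoints of chords of $C$ by $1,\dots,2k$ along the circle. For $n\ge 2$ put $f(x_1,\dots,x_{2k})=\mathrm{Tr}(\mathrm{ad}_{x_1}\cdots\mathrm{ad}_{x_{2k}})$ (trace of an operator on $sl(n)$, the Lie algebra of traceless $n\times n$ matrices over a field of characteristic $0$; for $k=0$ this is $n^2-1$). For every chord with endpoints $a,b$ contract the arguments $x_a,x_b$: substitute $x_a=\alpha$, $x_b=\tilde\alpha$ and sum over $\alpha$ in a basis of $sl(n)$, with $\tilde\alpha$ the dual basis with respect to $\langle X,Y\rangle=\mathrm{Tr}(XY)$. The resulting scalar is a polynomial in $n$ of degree at most $k+2$; this polynomial is denoted $U(C)$. *)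

theory Defs
  imports
    "Jordan_Normal_Form.VS_Connect"
    "HOL-Library.Disjoint_Sets"
    "HOL-Computational_Algebra.Polynomial"
begin

text \<open>
  A chord diagram is represented by the perfect matching obtained by numbering the endpoints
  consecutively along the circle, starting from an arbitrary endpoint. Cutting the circle open
  in this way does not affect which pairs of chords alternate.
\<close>

definition chord_diagram :: "nat set set \<Rightarrow> bool" where
  "chord_diagram C \<longleftrightarrow> partition_on {1..2 * card C} C \<and> (\<forall>c\<in>C. card c = 2)"

definition chords_intersect :: "nat set \<Rightarrow> nat set \<Rightarrow> bool" where
  "chords_intersect c d \<longleftrightarrow>
     (\<exists>p q r s. p < q \<and> q < r \<and> r < s \<and>
        ((c = {p, r} \<and> d = {q, s}) \<or> (d = {p, r} \<and> c = {q, s})))"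

definition pairwise_nonintersecting :: "nat set set \<Rightarrow> bool" where
  "pairwise_nonintersecting F \<longleftrightarrow> (\<forall>c\<in>F. \<forall>d\<in>F. c \<noteq> d \<longrightarrow> \<not> chords_intersect c d)"

definition splittings :: "nat set set \<Rightarrow> (nat set set \<times> nat set set) set" where
  "splittings C = {(F, G). F \<union> G = C \<and> F \<inter> G = {} \<and>
     pairwise_nonintersecting F \<and> pairwise_nonintersecting G}"

definition d_diagram :: "nat set set \<Rightarrow> bool" where
  "d_diagram C \<longleftrightarrow> chord_diagram C \<and> (\<exists>F G. (F, G) \<in> splittings C)"


context vectorspace
begin

definition coords :: "'c set \<Rightarrow> 'c \<Rightarrow> 'c \<Rightarrow> 'a" where
  "coords B v = (THE a. a \<in> B \<rightarrow>\<^sub>E carrier K \<and> lincomb a B = v)"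

text \<open>The trace of an endomorphism of a finite-dimensional space: the sum of the diagonal
  entries of its matrix in some (equivalently, any) basis.\<close>

definition op_trace :: "('c \<Rightarrow> 'c) \<Rightarrow> 'a" where
  "op_trace T = (let B = (SOME B. finite B \<and> basis B) in \<Oplus>\<^bsub>K\<^esub>b\<in>B. coords B (T b) b)"

end


definition mat_trace :: "'a::comm_monoid_add mat \<Rightarrow> 'a" where
  "mat_trace A = (\<Sum>i<dim_row A. A $$ (i, i))"

definition sl :: "nat \<Rightarrow> ('a::field, 'a mat) module" where
  "sl n = (module_mat TYPE('a) n n)\<lparr>carrier := {A \<in> carrier_mat n n. mat_trace A = 0}\<rparr>"

lemma vectorspace_sl: "vectorspace class_ring (sl n :: ('a::field, 'a mat) module)"
proof -
  interpret M: matrix_vs n n "TYPE('a)" .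
  let ?W = "{A \<in> carrier_mat n n. mat_trace A = 0} :: 'a mat set"
  have "VectorSpace.subspace class_ring ?W (module_mat TYPE('a) n n)"
    by (intro VectorSpace.subspace.intro submodule.intro M.module.module_axioms M.vectorspace_axioms)
      (auto simp: module_mat_simps mat_trace_def sum.distrib simp flip: sum_distrib_left)
  then show ?thesis
    unfolding sl_def by (rule M.subspace_is_vs)
qed

definition ad :: "'a::ring mat \<Rightarrow> 'a mat \<Rightarrow> 'a mat" where
  "ad x y = x * y - y * x"

definition ad_trace :: "nat \<Rightarrow> 'a::field mat list \<Rightarrow> 'a" where
  "ad_trace n xs = vectorspace.op_trace class_ring (sl n) (foldr (\<lambda>x T. ad x \<circ> T) xs id)"

text \<open>A basis \<open>B\<close> of \<open>sl n\<close> together with the map \<open>\<delta>\<close> taking each of its elements to the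
  corresponding element of the dual basis for the form \<open>Tr(XY)\<close>.\<close>

definition dual_bases :: "nat \<Rightarrow> 'a::field mat set \<Rightarrow> ('a mat \<Rightarrow> 'a mat) \<Rightarrow> bool" where
  "dual_bases n B \<delta> \<longleftrightarrow>
     finite B \<and> vectorspace.basis class_ring (sl n) B \<and>
     (\<forall>\<alpha>\<in>B. \<delta> \<alpha> \<in> carrier (sl n)) \<and>
     (\<forall>\<alpha>\<in>B. \<forall>\<beta>\<in>B. mat_trace (\<alpha> * \<delta> \<beta>) = (if \<alpha> = \<beta> then 1 else 0))"

text \<open>All chords are contracted simultaneously: \<open>\<phi>\<close> assigns a basis element to each chord,
  which is put at the smaller endpoint, and its dual at the larger one. (Since
  \<open>\<Sum>\<alpha> \<otimes> \<delta> \<alpha>\<close> is a symmetric tensor, the order of the endpoints is immaterial.)\<close>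

definition contraction ::
    "nat \<Rightarrow> 'a::field mat set \<Rightarrow> ('a mat \<Rightarrow> 'a mat) \<Rightarrow> nat set set \<Rightarrow> 'a" where
  "contraction n B \<delta> C =
     (\<Sum>\<phi> \<in> C \<rightarrow>\<^sub>E B. ad_trace n
        (map (\<lambda>i. let c = (THE c. c \<in> C \<and> i \<in> c) in if i = Min c then \<phi> c else \<delta> (\<phi> c))
          [1..<2 * card C + 1]))"

text \<open>The polynomial \<open>p\<close> takes, at every \<open>n \<ge> 2\<close>, the value of the contraction over \<open>sl n\<close>,
  whichever basis is used to compute the latter.\<close>

definition represents_U :: "nat set set \<Rightarrow> 'a::field_char_0 poly \<Rightarrow> bool" where
  "represents_U C p \<longleftrightarrow>
     (\<forall>n\<ge>2. \<forall>B \<delta>. dual_bases n B \<delta> \<longrightarrow> poly p (of_nat n) = contraction n B \<delta> C)"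

definition U_poly :: "nat set set \<Rightarrow> 'a::field_char_0 poly" where
  "U_poly C = (THE p. represents_U C p)"

end

theory Submission
  imports Defs
begin

text \<open>
  Why the theorem holds. Since \<open>ad\<close> kills scalar matrices and maps into the traceless ones,
  everything may be computed with all \<open>n \<times> n\<close> matrices instead of the traceless ones: the trace of a
  nonempty product of adjoint operators is unchanged (\<open>ad_trace_eq\<close>), and the tensor of dual bases
  of \<open>sl n\<close> may be replaced by \<open>\<Sum> E\<^sub>i\<^sub>j \<otimes> E\<^sub>j\<^sub>i\<close>, from which it differs by a multiple of
  \<open>1 \<otimes> 1\<close> (\<open>contract_chord_dual_bases\<close>). The empty product contributes an extra \<open>-1\<close>,
  a constant, which is below the top degree \<open>2\<close> of that case.

  Now expand every \<open>ad x\<close> as left minus right multiplication by \<open>x\<close>. A choice of the set \<open>S\<close> of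
  endpoints that act from the left gives the operator \<open>Y \<mapsto> A * Y * B\<close>, where \<open>A\<close> is the product of the
  letters in \<open>S\<close> in increasing order and \<open>B\<close> that of the other letters in decreasing order; its trace
  is \<open>Tr A * Tr B\<close>, and it comes with a sign for every endpoint outside \<open>S\<close>
  (\<open>sum_diagonal_ad_prod\<close>).

  It remains to contract a product of traces of words along chords. Contracting a chord whose ends lie
  in one word cuts this word into two (\<open>fission\<close>); if they lie in two words, these merge into one
  (\<open>fusion\<close>). When no chords are left, every word is empty and has trace \<open>n\<close>. So each choice of
  \<open>S\<close> contributes plus or minus a power of \<open>n\<close>. Fission raises the number of words by one and fusion
  lowers it, hence with \<open>k\<close> chords and two initial words the exponent is at most \<open>k + 2\<close>, with
  equality if and only if only fissions occur. This means that no chord joins \<open>S\<close> to its complement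
  and that no two chords on the same side intersect (\<open>contract_word_traces\<close>): exactly an ordered
  splitting of the chords into two nonintersecting families. For such an \<open>S\<close> the complement consists
  of whole chords, so it has even size and the sign is positive. Nothing cancels in degree \<open>k + 2\<close>, and the
  coefficient counts the splittings.

  Finally, the polynomial is determined by its values, because dual bases exist for every \<open>n \<ge> 2\<close>
  (\<open>dual_bases_exist\<close>, \<open>represents_U_unique\<close>).
\<close>

section \<open>Traces of words in matrix units\<close>

definition unit_mat :: "nat \<Rightarrow> nat \<times> nat \<Rightarrow> 'a::comm_ring_1 mat" where
  "unit_mat n p = mat n n (\<lambda>q. if q = p then 1 else 0)"

abbreviation indices :: "nat \<Rightarrow> (nat \<times> nat) set" where
  "indices n \<equiv> {..<n} \<times> {..<n}"

definition mat_prod :: "nat \<Rightarrow> 'a::comm_ring_1 mat list \<Rightarrow> 'a mat" where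
  "mat_prod n xs = foldr (*) xs (1\<^sub>m n)"

lemma unit_mat_carrier [simp]: "unit_mat n p \<in> carrier_mat n n"
  by (simp add: unit_mat_def)

lemma unit_mat_dim [simp]: "dim_row (unit_mat n p) = n" "dim_col (unit_mat n p) = n"
  by (simp_all add: unit_mat_def)

lemma unit_mat_index [simp]:
  "r < n \<Longrightarrow> s < n \<Longrightarrow> unit_mat n p $$ (r, s) = (if (r, s) = p then 1 else 0)"
  by (simp add: unit_mat_def)

lemma mat_mult_index:
  assumes "A \<in> carrier_mat n n" "B \<in> carrier_mat n n" "r < n" "s < n"
  shows "(A * B) $$ (r, s) = (\<Sum>t<n. A $$ (r, t) * B $$ (t, s))"
  using assms by (auto simp: scalar_prod_def atLeast0LessThan intro!: sum.cong)

lemma square_mat_assoc: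
  fixes A B D :: "'a::comm_ring_1 mat"
  assumes "A \<in> carrier_mat n n" "B \<in> carrier_mat n n" "D \<in> carrier_mat n n"
  shows "A * B * D = A * (B * D)"
  by (rule assoc_mult_mat[OF assms])

lemma square_mat_mult_carrier [simp]:
  "A \<in> carrier_mat n n \<Longrightarrow> B \<in> carrier_mat n n \<Longrightarrow> A * B \<in> carrier_mat n n"
  by (rule mult_carrier_mat)

lemma unit_mat_mult_index:
  fixes A :: "'a::comm_ring_1 mat"
  assumes "A \<in> carrier_mat n n" "r < n" "s < n" "j < n"
  shows "(unit_mat n (i, j) * A) $$ (r, s) = (if r = i then A $$ (j, s) else 0)"
proof -
  have "(unit_mat n (i, j) * A) $$ (r, s) = (\<Sum>t<n. if t = j then (if r = i then A $$ (t, s) else 0) else 0)"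
    by (subst mat_mult_index[OF unit_mat_carrier assms(1-3)])
      (rule sum.cong, use assms in auto)
  then show ?thesis using assms by simp
qed

lemma mat_trace_mult:
  assumes "A \<in> carrier_mat n n" "B \<in> carrier_mat n n"
  shows "mat_trace (A * B) = (\<Sum>r<n. \<Sum>s<n. A $$ (r, s) * B $$ (s, r))"
  using assms mat_mult_index[OF assms] by (auto simp: mat_trace_def)

lemma mat_trace_comm:
  fixes A :: "'a::comm_ring_1 mat"
  assumes "A \<in> carrier_mat n n" "B \<in> carrier_mat n n"
  shows "mat_trace (A * B) = mat_trace (B * A)"
  unfolding mat_trace_mult[OF assms] mat_trace_mult[OF assms(2,1)]
  by (subst sum.swap) (simp add: mult.commute)

lemma mat_trace_sandwich:
  fixes A B :: "'a::comm_ring_1 mat"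
  assumes "A \<in> carrier_mat n n" "B \<in> carrier_mat n n" "i < n" "j < n"
  shows "mat_trace (A * (unit_mat n (i, j) * B)) = (B * A) $$ (j, i)"
proof -
  have "mat_trace (A * (unit_mat n (i, j) * B)) = mat_trace (unit_mat n (i, j) * B * A)"
    using assms by (intro mat_trace_comm[where n = n]) simp_all
  also have "\<dots> = mat_trace (unit_mat n (i, j) * (B * A))"
    using assms by (simp add: square_mat_assoc[where n = n])
  also have "\<dots> = (\<Sum>r<n. (unit_mat n (i, j) * (B * A)) $$ (r, r))"
    unfolding mat_trace_def by (simp add: unit_mat_def)
  also have "\<dots> = (\<Sum>r<n. if r = i then (B * A) $$ (j, r) else 0)"
    using assms by (intro sum.cong refl unit_mat_mult_index[where n = n]) auto
  also have "\<dots> = (B * A) $$ (j, i)"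
    using assms by simp
  finally show ?thesis .
qed

lemma sum_indices: "(\<Sum>p\<in>indices n. f p) = (\<Sum>i<n. \<Sum>j<n. f (i, j))"
  by (simp add: sum.cartesian_product)

lemma sum_indices_swap: "(\<Sum>p\<in>indices n. f (prod.swap p)) = (\<Sum>p\<in>indices n. f p)"
  by (rule sum.reindex_bij_witness[where i = prod.swap and j = prod.swap]) auto

text \<open>
  The tensor of matrix units acts as the flip on pairs of vectors: removing the two contracted letters
  joins the four loose ends crosswise. Here the letters sit in different traces, which merge.
\<close>

lemma fusion:
  fixes P Q R S :: "'a::comm_ring_1 mat"
  assumes "P \<in> carrier_mat n n" "Q \<in> carrier_mat n n" "R \<in> carrier_mat n n" "S \<in> carrier_mat n n"
  shows "(\<Sum>p\<in>indices n. mat_trace (P * (unit_mat n p * Q)) * mat_trace (R * (unit_mat n (prod.swap p) * S)))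
    = mat_trace ((Q * P) * (S * R))"
proof -
  have "(\<Sum>p\<in>indices n. mat_trace (P * (unit_mat n p * Q)) * mat_trace (R * (unit_mat n (prod.swap p) * S)))
    = (\<Sum>i<n. \<Sum>j<n. (Q * P) $$ (j, i) * (S * R) $$ (i, j))"
    unfolding sum_indices using assms by (intro sum.cong refl) (simp add: mat_trace_sandwich[where n = n] del: index_mult_mat(1))
  also have "\<dots> = (\<Sum>j<n. \<Sum>i<n. (Q * P) $$ (j, i) * (S * R) $$ (i, j))"
    by (rule sum.swap)
  also have "\<dots> = mat_trace ((Q * P) * (S * R))"
    using assms by (intro mat_trace_mult[symmetric]) simp_all
  finally show ?thesis .
qed

text \<open>
  The same crosswise joining when both letters sit in one trace, which then falls apart.
\<close>

lemma fission:
  fixes P A Q :: "'a::comm_ring_1 mat"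
  assumes "P \<in> carrier_mat n n" "A \<in> carrier_mat n n" "Q \<in> carrier_mat n n"
  shows "(\<Sum>p\<in>indices n. mat_trace (P * (unit_mat n p * (A * (unit_mat n (prod.swap p) * Q)))))
    = mat_trace A * mat_trace (P * Q)"
proof -
  have inner: "mat_trace (P * (unit_mat n (i, j) * (A * (unit_mat n (j, i) * Q))))
      = A $$ (j, j) * (Q * P) $$ (i, i)" if ij: "i < n" "j < n" for i j
  proof -
    have "mat_trace (P * (unit_mat n (i, j) * (A * (unit_mat n (j, i) * Q))))
      = ((A * (unit_mat n (j, i) * Q)) * P) $$ (j, i)"
      using assms ij by (intro mat_trace_sandwich) simp_all
    also have "(A * (unit_mat n (j, i) * Q)) * P = A * (unit_mat n (j, i) * (Q * P))"
      using assms by (simp add: square_mat_assoc[where n = n])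
    also have "\<dots> $$ (j, i) = (\<Sum>t<n. A $$ (j, t) * (unit_mat n (j, i) * (Q * P)) $$ (t, i))"
      using assms ij by (intro mat_mult_index) simp_all
    also have "\<dots> = (\<Sum>t<n. if t = j then A $$ (j, t) * (Q * P) $$ (i, i) else 0)"
      using assms ij
      by (intro sum.cong refl) (simp add: unit_mat_mult_index[where n = n] del: index_mult_mat(1))
    finally show ?thesis using ij by simp
  qed
  have QP: "mat_trace (P * Q) = (\<Sum>i<n. (Q * P) $$ (i, i))"
    using assms by (subst mat_trace_comm[OF assms(1,3)]) (simp add: mat_trace_def)
  have "(\<Sum>p\<in>indices n. mat_trace (P * (unit_mat n p * (A * (unit_mat n (prod.swap p) * Q)))))
    = (\<Sum>i<n. \<Sum>j<n. A $$ (j, j) * (Q * P) $$ (i, i))"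
    unfolding sum_indices by (intro sum.cong refl) (simp add: inner del: index_mult_mat(1))
  also have "\<dots> = (\<Sum>j<n. \<Sum>i<n. A $$ (j, j) * (Q * P) $$ (i, i))"
    by (rule sum.swap)
  also have "\<dots> = mat_trace A * mat_trace (P * Q)"
    using assms(2) unfolding QP by (simp add: sum_product mat_trace_def del: index_mult_mat(1))
  finally show ?thesis .
qed

lemma mat_prod_simps [simp]: "mat_prod n [] = 1\<^sub>m n" "mat_prod n (x # xs) = x * mat_prod n xs"
  by (simp_all add: mat_prod_def)

lemma mat_prod_carrier [simp]:
  "(\<And>x. x \<in> set xs \<Longrightarrow> x \<in> carrier_mat n n) \<Longrightarrow> mat_prod n xs \<in> carrier_mat n n"
  by (induction xs) simp_all

lemma mat_prod_append:
  "(\<And>x. x \<in> set (xs @ ys) \<Longrightarrow> x \<in> carrier_mat n n) \<Longrightarrow>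
    mat_prod n (xs @ ys) = mat_prod n xs * mat_prod n ys"
proof (induction xs)
  case Nil
  then have "mat_prod n ys \<in> carrier_mat n n" by (intro mat_prod_carrier) simp
  then show ?case by simp
next
  case (Cons x xs)
  then have "mat_prod n xs \<in> carrier_mat n n" "mat_prod n ys \<in> carrier_mat n n"
    by (auto intro!: mat_prod_carrier)
  with Cons show ?case by (simp add: square_mat_assoc[where n = n])
qed

definition word_traces :: "nat \<Rightarrow> nat list list \<Rightarrow> (nat \<Rightarrow> 'a::comm_ring_1 mat) \<Rightarrow> 'a" where
  "word_traces n ws g = (\<Prod>w\<leftarrow>ws. mat_trace (mat_prod n (map g w)))"

text \<open>
  The outer pieces \<open>P\<close> and \<open>Q\<close> are joined in their given order, so a word written in increasing
  or decreasing order leaves pieces that are again written in this order.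
\<close>

lemma word_traces_fission:
  fixes g :: "nat \<Rightarrow> 'a::comm_ring_1 mat"
  assumes "distinct (P @ x # A @ y # Q)" "{x, y} \<inter> set (concat ws) = {}"
    and g: "\<And>i. i \<in> set (concat ((P @ A @ Q) # ws)) \<Longrightarrow> g i \<in> carrier_mat n n"
  shows "(\<Sum>p\<in>indices n. word_traces n ((P @ x # A @ y # Q) # ws)
      (g(x := unit_mat n p, y := unit_mat n (prod.swap p))))
    = word_traces n (A # (P @ Q) # ws) g"
proof -
  have w: "word_traces n ws (g(x := X, y := Y)) = word_traces n ws g" for X Y
    unfolding word_traces_def using assms(2)
    by (intro arg_cong[where f = prod_list] map_cong refl arg_cong[where f = "\<lambda>l. mat_trace (mat_prod n l)"]) auto
  have m: "map (g(x := X, y := Y)) (P @ x # A @ y # Q) = map g P @ X # map g A @ Y # map g Q" for X Y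
    using assms(1) by auto
  have c: "mat_prod n (map g P) \<in> carrier_mat n n" "mat_prod n (map g A) \<in> carrier_mat n n"
    "mat_prod n (map g Q) \<in> carrier_mat n n"
    using g by (auto intro!: mat_prod_carrier)
  have pr: "mat_prod n (map g P @ X # map g A @ Y # map g Q) =
    mat_prod n (map g P) * (X * (mat_prod n (map g A) * (Y * mat_prod n (map g Q))))"
    if "X \<in> carrier_mat n n" "Y \<in> carrier_mat n n" for X Y
    using g that by (subst mat_prod_append, force, simp, subst mat_prod_append) auto
  have pq: "mat_prod n (map g P) * mat_prod n (map g Q) = mat_prod n (map g P @ map g Q)"
    using g by (subst mat_prod_append) auto
  have "word_traces n ((P @ x # A @ y # Q) # ws) (g(x := X, y := Y)) =
    mat_trace (mat_prod n (map g P) * (X * (mat_prod n (map g A) * (Y * mat_prod n (map g Q)))))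
      * word_traces n ws g"
    if "X \<in> carrier_mat n n" "Y \<in> carrier_mat n n" for X Y
    using w[of X Y] by (simp only: word_traces_def list.map prod_list.Cons m pr[OF that])
  then show ?thesis
    using fission[OF c]
    by (simp add: sum_distrib_right[symmetric] pq) (simp add: word_traces_def mult_ac)
qed

lemma word_traces_fusion:
  fixes g :: "nat \<Rightarrow> 'a::comm_ring_1 mat"
  assumes "distinct ((P @ x # Q) @ (R @ y # S))" "{x, y} \<inter> set (concat ws) = {}"
    and g: "\<And>i. i \<in> set (concat ((P @ Q) # (R @ S) # ws)) \<Longrightarrow> g i \<in> carrier_mat n n"
  shows "(\<Sum>p\<in>indices n. word_traces n ((P @ x # Q) # (R @ y # S) # ws)
      (g(x := unit_mat n p, y := unit_mat n (prod.swap p))))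
    = word_traces n ((Q @ P @ S @ R) # ws) g"
proof -
  have w: "word_traces n ws (g(x := X, y := Y)) = word_traces n ws g" for X Y
    unfolding word_traces_def using assms(2)
    by (intro arg_cong[where f = prod_list] map_cong refl arg_cong[where f = "\<lambda>l. mat_trace (mat_prod n l)"]) auto
  have m: "map (g(x := X, y := Y)) (P @ x # Q) = map g P @ X # map g Q"
     "map (g(x := X, y := Y)) (R @ y # S) = map g R @ Y # map g S" for X Y
    using assms(1) by auto
  have c: "mat_prod n (map g P) \<in> carrier_mat n n" "mat_prod n (map g Q) \<in> carrier_mat n n"
    "mat_prod n (map g R) \<in> carrier_mat n n" "mat_prod n (map g S) \<in> carrier_mat n n"
    using g by (auto intro!: mat_prod_carrier)
  have pr: "mat_prod n (map g P @ X # map g Q) = mat_prod n (map g P) * (X * mat_prod n (map g Q))"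
    "mat_prod n (map g R @ X # map g S) = mat_prod n (map g R) * (X * mat_prod n (map g S))"
    if "X \<in> carrier_mat n n" for X
    using g that by (subst mat_prod_append, force, simp)+
  have "mat_prod n (map g Q @ map g P @ map g S @ map g R) =
     (mat_prod n (map g Q) * mat_prod n (map g P)) * (mat_prod n (map g S) * mat_prod n (map g R))"
    using g by (subst mat_prod_append[of "map g Q @ map g P" "map g S @ map g R", simplified],
      force, (subst mat_prod_append, force)+, simp)
  moreover have "word_traces n ((P @ x # Q) # (R @ y # S) # ws) (g(x := X, y := Y)) =
    mat_trace (mat_prod n (map g P) * (X * mat_prod n (map g Q))) *
    mat_trace (mat_prod n (map g R) * (Y * mat_prod n (map g S))) * word_traces n ws g"
    if "X \<in> carrier_mat n n" "Y \<in> carrier_mat n n" for X Y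
    using w[of X Y]
    by (simp only: word_traces_def list.map prod_list.Cons m pr(1)[OF that(1)] pr(2)[OF that(2)] mult.assoc)
  ultimately show ?thesis
    using fusion[OF c]
    by (simp add: sum_distrib_right[symmetric]) (simp add: word_traces_def)
qed

section \<open>Contraction along a set of chords\<close>

definition chord_set :: "nat set set \<Rightarrow> bool" where
  "chord_set C \<longleftrightarrow> finite C \<and> disjoint C \<and> (\<forall>c\<in>C. card c = 2)"

text \<open>
  The background \<open>g\<close> supplies the letters outside the chords, which allows the chords to be filled one
  at a time.
\<close>

definition place :: "nat set set \<Rightarrow> ('b \<Rightarrow> 'm) \<Rightarrow> ('b \<Rightarrow> 'm) \<Rightarrow> (nat set \<Rightarrow> 'b) \<Rightarrow> (nat \<Rightarrow> 'm) \<Rightarrow> nat \<Rightarrow> 'm" where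
  "place C u v \<phi> g i =
    (if i \<in> \<Union>C then let c = (THE c. c \<in> C \<and> i \<in> c) in if i = Min c then u (\<phi> c) else v (\<phi> c) else g i)"

text \<open>
  The triple \<open>(I, u, v)\<close> presents the tensor \<open>\<Sum>t\<in>I. u t \<otimes> v t\<close> that is inserted along every chord.
\<close>

definition contract ::
    "'b set \<Rightarrow> ('b \<Rightarrow> 'm) \<Rightarrow> ('b \<Rightarrow> 'm) \<Rightarrow> nat set set \<Rightarrow> (nat \<Rightarrow> 'm) \<Rightarrow> ((nat \<Rightarrow> 'm) \<Rightarrow> 'a::comm_monoid_add) \<Rightarrow> 'a" where
  "contract I u v C g F = (\<Sum>\<phi> \<in> C \<rightarrow>\<^sub>E I. F (place C u v \<phi> g))"

lemma chord_set_insertD: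
  assumes "chord_set (insert c C)" "c \<notin> C"
  shows "chord_set C" "c \<inter> \<Union>C = {}" "card c = 2"
  using assms unfolding chord_set_def disjoint_def by fastforce+

lemma chord_eq_Min_Max:
  fixes c :: "nat set"
  assumes "card c = 2"
  shows "c = {Min c, Max c}" "Min c < Max c"
proof -
  obtain x y where "c = {x, y}" "x \<noteq> y" using assms by (auto simp: card_2_iff)
  then have "c = {Min c, Max c} \<and> Min c < Max c" by (cases "x < y") (auto simp: max_def min_def)
  then show "c = {Min c, Max c}" "Min c < Max c" by auto
qed

lemma the_chord:
  assumes "disjoint C" "c \<in> C" "i \<in> c"
  shows "(THE d. d \<in> C \<and> i \<in> d) = c"
  using assms unfolding disjoint_def by (intro the_equality) auto

lemma place_eq:
  assumes "disjoint C" "c \<in> C" "i \<in> c"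
  shows "place C u v \<phi> g i = (if i = Min c then u (\<phi> c) else v (\<phi> c))"
  using assms the_chord[OF assms] by (auto simp: place_def Let_def)

lemma place_outside: "i \<notin> \<Union>C \<Longrightarrow> place C u v \<phi> g i = g i"
  by (simp add: place_def)

lemma place_update:
  "x \<notin> \<Union>C \<Longrightarrow> place C u v \<phi> (g(x := X)) = (place C u v \<phi> g)(x := X)"
  by (auto simp: place_def fun_eq_iff)

lemma place_insert:
  assumes "chord_set (insert c C)" "c \<notin> C"
  shows "place (insert c C) u v (\<phi>(c := t)) g = (place C u v \<phi> g)(Min c := u t, Max c := v t)" (is "?l = ?r")
    and "place (insert c C) u v (\<phi>(c := t)) g = place C u v \<phi> (g(Min c := u t, Max c := v t))" (is "_ = ?r'")
proof -
  have dC: "disjoint C" "disjoint (insert c C)"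
    using assms chord_set_insertD[OF assms] by (auto simp: chord_set_def)
  note cC = chord_set_insertD(2)[OF assms]
  note c = chord_eq_Min_Max[OF chord_set_insertD(3)[OF assms]]
  have "?l i = ?r i \<and> ?l i = ?r' i" for i
  proof (cases "i \<in> \<Union>(insert c C)")
    case False
    then have "i \<notin> c" "i \<notin> \<Union>C" by auto
    moreover have "i \<noteq> Min c" "i \<noteq> Max c" using \<open>i \<notin> c\<close> c(1) by auto
    ultimately show ?thesis using False by (simp add: place_outside)
  next
    case True
    show ?thesis
    proof (cases "i \<in> c")
      case True
      then have "i \<notin> \<Union>C" using cC by auto
      moreover have "i = Min c \<or> i = Max c" using True c(1) by blast
      ultimately show ?thesis
        using place_eq[OF dC(2) insertI1 True, of u v "\<phi>(c := t)" g] c(2) by (auto simp: place_outside)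
    next
      case False
      then obtain d where d: "d \<in> C" "i \<in> d" using True by auto
      moreover have "i \<noteq> Min c" "i \<noteq> Max c" using False c(1) by auto
      moreover have "d \<noteq> c" using d assms by auto
      ultimately show ?thesis
        using place_eq[OF dC(2) insertI2 d(2), OF d(1), of u v "\<phi>(c := t)" g] by (simp add: place_eq[OF dC(1) d])
    qed
  qed
  then show "?l = ?r" "?l = ?r'" by blast+
qed

lemma place_carrier:
  assumes "disjoint C" "\<phi> \<in> C \<rightarrow>\<^sub>E I" "\<And>t. t \<in> I \<Longrightarrow> u t \<in> M" "\<And>t. t \<in> I \<Longrightarrow> v t \<in> M" "i \<in> \<Union>C"
  shows "place C u v \<phi> g i \<in> M"
proof -
  obtain c where c: "c \<in> C" "i \<in> c" using assms by auto
  show ?thesis unfolding place_eq[OF assms(1) c] using assms c by (auto simp: PiE_mem)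
qed

lemma sum_PiE_insert:
  assumes "c \<notin> C"
  shows "(\<Sum>\<phi>\<in>insert c C \<rightarrow>\<^sub>E I. F \<phi>) = (\<Sum>t\<in>I. \<Sum>\<phi>\<in>C \<rightarrow>\<^sub>E I. F (\<phi>(c := t)))"
  unfolding PiE_insert_eq
  by (subst sum.reindex[OF inj_combinator[OF assms]]) (simp add: case_prod_unfold sum.cartesian_product)

lemma contract_empty: "contract I u v {} g F = F g"
  by (simp add: contract_def place_def[abs_def])

text \<open>
  A chord can be contracted last, by filling its ends in the background, or first, by contracting the
  functional (\<open>contract_insert_inner\<close>). The first form suits an induction that varies the
  background, the second one makes an identity for a single chord applicable.
\<close>

lemma contract_insert_outer:
  assumes "chord_set (insert c C)" "c \<notin> C"
  shows "contract I u v (insert c C) g F = (\<Sum>t\<in>I. contract I u v C (g(Min c := u t, Max c := v t)) F)"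
  unfolding contract_def sum_PiE_insert[OF assms(2)] place_insert(2)[OF assms] ..

lemma contract_insert_inner:
  assumes "chord_set (insert c C)" "c \<notin> C"
  shows "contract I u v (insert c C) g F = contract I u v C g (\<lambda>h. \<Sum>t\<in>I. F (h(Min c := u t, Max c := v t)))"
  unfolding contract_def sum_PiE_insert[OF assms(2)] place_insert(1)[OF assms]
  by (rule sum.swap)

lemma contract_cong:
  assumes "chord_set C" "\<And>t. t \<in> I \<Longrightarrow> u t \<in> M" "\<And>t. t \<in> I \<Longrightarrow> v t \<in> M"
    and "\<And>h. (\<And>i. i \<in> \<Union>C \<Longrightarrow> h i \<in> M) \<Longrightarrow> F h = F' h"
  shows "contract I u v C g F = contract I u v C g F'"
  unfolding contract_def using assms(1)
  by (intro sum.cong refl assms(4) place_carrier[OF _ _ assms(2,3)]) (auto simp: chord_set_def)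

text \<open>
  Two presentations of the inserted tensor may agree only as seen by \<open>F\<close>. As \<open>F\<close> can be tested on one
  chord with all the other places held fixed, the chords are exchanged one after the other.
\<close>

lemma contract_change_tensor:
  assumes "chord_set C"
    and "\<And>t. t \<in> I \<Longrightarrow> u t \<in> M" "\<And>t. t \<in> I \<Longrightarrow> v t \<in> M"
    and "\<And>t. t \<in> J \<Longrightarrow> u' t \<in> M" "\<And>t. t \<in> J \<Longrightarrow> v' t \<in> M"
    and "\<And>c h. c \<in> C \<Longrightarrow> (\<And>i. h i \<in> M) \<Longrightarrow>
      (\<Sum>t\<in>I. F (h(Min c := u t, Max c := v t))) = (\<Sum>t\<in>J. F (h(Min c := u' t, Max c := v' t)))"
    and "\<And>i. g i \<in> M"
  shows "contract I u v C g F = contract J u' v' C g F"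
proof -
  have "finite C" using assms(1) by (simp add: chord_set_def)
  then show ?thesis using assms(1,6,7)
  proof (induction C arbitrary: g)
    case empty
    then show ?case by (simp add: contract_empty)
  next
    case (insert c C)
    note ins = insert.prems(1) insert.hyps(2)
    have ends: "Min c \<notin> \<Union>C" "Max c \<notin> \<Union>C"
      using chord_set_insertD(2)[OF ins] chord_eq_Min_Max(1)[OF chord_set_insertD(3)[OF ins]] by blast+
    have "contract I u v (insert c C) g F = (\<Sum>t\<in>I. contract I u v C (g(Min c := u t, Max c := v t)) F)"
      by (rule contract_insert_outer[OF ins])
    also have "\<dots> = (\<Sum>t\<in>I. contract J u' v' C (g(Min c := u t, Max c := v t)) F)"
      using chord_set_insertD[OF ins] insert.prems assms(2,3)
      by (intro sum.cong refl insert.IH) auto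
    also have "\<dots> = contract J u' v' C g (\<lambda>h. \<Sum>t\<in>I. F (h(Min c := u t, Max c := v t)))"
      unfolding contract_def using ends by (subst sum.swap) (simp add: place_update)
    also have "\<dots> = contract J u' v' C g (\<lambda>h. \<Sum>t\<in>J. F (h(Min c := u' t, Max c := v' t)))"
    proof -
      have "place C u' v' \<phi> g i \<in> M" if "\<phi> \<in> C \<rightarrow>\<^sub>E J" for \<phi> i
      proof (cases "i \<in> \<Union>C")
        case True
        then show ?thesis
          using that assms(4,5) chord_set_insertD(1)[OF ins]
          by (intro place_carrier[of C \<phi> J]) (auto simp: chord_set_def)
      qed (use insert.prems in \<open>auto simp: place_outside\<close>)
      then show ?thesis
        unfolding contract_def by (intro sum.cong refl insert.prems(2)) auto
    qed
    also have "\<dots> = contract J u' v' (insert c C) g F"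
      by (rule contract_insert_inner[OF ins, symmetric])
    finally show ?case .
  qed
qed

section \<open>Planar systems of words\<close>

lemma chords_intersect_commute: "chords_intersect c d \<longleftrightarrow> chords_intersect d c"
  unfolding chords_intersect_def by blast

lemma chords_intersect_iff:
  assumes "a < b" "e < f"
  shows "chords_intersect {a, b} {e, f} \<longleftrightarrow> a < e \<and> e < b \<and> b < f \<or> e < a \<and> a < f \<and> f < b"
proof
  assume "chords_intersect {a, b} {e, f}"
  then show "a < e \<and> e < b \<and> b < f \<or> e < a \<and> a < f \<and> f < b"
    using assms unfolding chords_intersect_def doubleton_eq_iff by (elim exE) linarith
next
  assume "a < e \<and> e < b \<and> b < f \<or> e < a \<and> a < f \<and> f < b"
  then show "chords_intersect {a, b} {e, f}"
    unfolding chords_intersect_def by blast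
qed

text \<open>
  If every word is drawn as a circle, these are the systems whose chords can be drawn inside the
  circles without intersections. For words that are monotone lists of positions, intersection in the
  word is intersection of chords on the line.
\<close>

definition planar :: "nat set set \<Rightarrow> nat list list \<Rightarrow> bool" where
  "planar C ws \<longleftrightarrow> (\<forall>c\<in>C. \<exists>w\<in>set ws. c \<subseteq> set w) \<and>
     (\<forall>w\<in>set ws. pairwise_nonintersecting {c \<in> C. c \<subseteq> set w})"

lemma planarD:
  assumes "planar C ws"
  shows "c \<in> C \<Longrightarrow> \<exists>w\<in>set ws. c \<subseteq> set w"
    and "w \<in> set ws \<Longrightarrow> c \<in> C \<Longrightarrow> d \<in> C \<Longrightarrow> c \<subseteq> set w \<Longrightarrow> d \<subseteq> set w \<Longrightarrow> c \<noteq> d \<Longrightarrow> \<not> chords_intersect c d"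
  using assms unfolding planar_def pairwise_nonintersecting_def by blast+

lemma planarI:
  assumes "\<And>c. c \<in> C \<Longrightarrow> \<exists>w\<in>set ws. c \<subseteq> set w"
    and "\<And>w c d. w \<in> set ws \<Longrightarrow> c \<in> C \<Longrightarrow> d \<in> C \<Longrightarrow> c \<subseteq> set w \<Longrightarrow> d \<subseteq> set w \<Longrightarrow> c \<noteq> d \<Longrightarrow> \<not> chords_intersect c d"
  shows "planar C ws"
  using assms unfolding planar_def pairwise_nonintersecting_def by blast

abbreviation monotone_word :: "nat list \<Rightarrow> bool" where
  "monotone_word w \<equiv> sorted w \<or> sorted (rev w)"

text \<open>
  A chord avoids another one if and only if it lies entirely on one of its two sides.
\<close>

lemma chord_outside_interval:
  assumes "card d = 2" "l < h" "l \<notin> d" "h \<notin> d"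
  shows "\<not> chords_intersect {l, h} d \<longleftrightarrow> d \<subseteq> {l<..<h} \<or> d \<inter> {l..h} = {}"
proof -
  define a b where "a = Min d" and "b = Max d"
  have d: "d = {a, b}" "a < b" using chord_eq_Min_Max[OF assms(1)] by (auto simp: a_def b_def)
  show ?thesis
    using assms unfolding d(1) chords_intersect_iff[OF assms(2) d(2)] using d(2) by auto
qed

lemma chords_inside_outside:
  assumes "card d = 2" "card e = 2" "d \<subseteq> {l<..<h}" "e \<inter> {l..h} = {}" "l < (h::nat)"
  shows "\<not> chords_intersect d e"
proof -
  have d: "d = {Min d, Max d}" "Min d < Max d" and e: "e = {Min e, Max e}" "Min e < Max e"
    using chord_eq_Min_Max assms by auto
  have "Min d \<in> {l<..<h}" "Max d \<in> {l<..<h}" "Min e \<notin> {l..h}" "Max e \<notin> {l..h}"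
    using d(1) e(1) assms(3,4) by blast+
  then show ?thesis
    by (subst d(1), subst e(1), subst chords_intersect_iff[OF d(2) e(2)]) auto
qed

text \<open>
  The cut-out piece of a monotone word fills the gap between the two removed letters, and the rest lies
  beyond them.
\<close>

lemma monotone_word_fission:
  assumes "monotone_word (P @ x # A @ y # Q)" "distinct (P @ x # A @ y # Q)"
  shows "set A \<subseteq> {min x y<..<max x y}" "set (P @ Q) \<inter> {min x y..max x y} = {}"
    "monotone_word A" "monotone_word (P @ Q)"
proof -
  have le: "(x < y \<and> (\<forall>a\<in>set A. x \<le> a \<and> a \<le> y) \<and> (\<forall>p\<in>set P. p \<le> x) \<and> (\<forall>q\<in>set Q. y \<le> q)) \<or>
    (y < x \<and> (\<forall>a\<in>set A. y \<le> a \<and> a \<le> x) \<and> (\<forall>p\<in>set P. x \<le> p) \<and> (\<forall>q\<in>set Q. q \<le> y))"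
    using assms by (auto simp: sorted_append)
  have ne: "x \<notin> set A" "y \<notin> set A" "x \<notin> set (P @ Q)" "y \<notin> set (P @ Q)"
    using assms(2) by auto
  show "set A \<subseteq> {min x y<..<max x y}"
  proof
    fix a assume "a \<in> set A"
    moreover from this have "a \<noteq> x" "a \<noteq> y" using ne by auto
    ultimately show "a \<in> {min x y<..<max x y}" using le by force
  qed
  have "p \<notin> {min x y..max x y}" if "p \<in> set (P @ Q)" for p
  proof -
    have "p \<noteq> x" "p \<noteq> y" using ne that by auto
    then show ?thesis using le that by force
  qed
  then show "set (P @ Q) \<inter> {min x y..max x y} = {}" by blast
  show "monotone_word A" "monotone_word (P @ Q)"
    using assms by (auto simp: sorted_append)
qed

text \<open>
  A chord of the word avoids \<open>{x, y}\<close> if and only if it lies entirely in one of the two pieces left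
  by the cut at \<open>x\<close> and \<open>y\<close>; and chords in different pieces are separated by \<open>{x, y}\<close>.
\<close>

lemma planar_fission:
  assumes C: "chord_set (insert {x, y} C)" "{x, y} \<notin> C"
    and dist: "distinct (concat ((P @ x # A @ y # Q) # ws))"
    and mono: "monotone_word (P @ x # A @ y # Q)"
  shows "planar (insert {x, y} C) ((P @ x # A @ y # Q) # ws) \<longleftrightarrow> planar C (A # (P @ Q) # ws)"
proof -
  let ?W = "P @ x # A @ y # Q" and ?c = "{x, y}"
  define l h where "l = min x y" and "h = max x y"
  have dW: "distinct ?W" using dist unfolding concat.simps distinct_append by blast
  have lh: "l < h" "?c = {l, h}" using dW by (auto simp: l_def h_def min_def max_def)
  have A: "set A \<subseteq> {l<..<h}" and PQ: "set (P @ Q) \<inter> {l..h} = {}"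
    using monotone_word_fission[OF mono dW] by (simp_all add: l_def h_def)
  have chordC: "card d = 2" "d \<inter> ?c = {}" "d \<noteq> {}" if "d \<in> C" for d
    using that C chord_set_insertD[OF C] by (auto simp: chord_set_def)
  have split: "\<not> chords_intersect ?c d \<longleftrightarrow> d \<subseteq> set A \<or> d \<subseteq> set (P @ Q)"
    if d: "d \<in> C" "d \<subseteq> set ?W" for d
  proof -
    have "\<not> chords_intersect ?c d \<longleftrightarrow> d \<subseteq> {l<..<h} \<or> d \<inter> {l..h} = {}"
      unfolding lh(2) using chordC[OF d(1)] lh by (intro chord_outside_interval) auto
    moreover have "d \<subseteq> set A \<union> set (P @ Q)" using d chordC(2)[OF d(1)] by auto
    moreover have "{l<..<h} \<subseteq> {l..h}" by auto
    ultimately show ?thesis using A PQ by blast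
  qed
  have disj: "set w \<inter> set ?W = {}" if "w \<in> set ws" for w
    using that dist by auto
  show ?thesis
  proof
    assume pl: "planar (insert ?c C) (?W # ws)"
    have inW: "d \<subseteq> set A \<or> d \<subseteq> set (P @ Q)" if d: "d \<in> C" "d \<subseteq> set ?W" for d
    proof -
      have "?c \<noteq> d" using d C(2) by blast
      then have "\<not> chords_intersect ?c d"
        by (intro planarD(2)[OF pl _ insertI1 insertI2[OF d(1)] _ d(2)]) auto
      then show ?thesis using split[OF d] by blast
    qed
    show "planar C (A # (P @ Q) # ws)"
    proof (rule planarI)
      fix d assume d: "d \<in> C"
      then obtain w where w: "w \<in> set (?W # ws)" "d \<subseteq> set w" using planarD(1)[OF pl] by blast
      show "\<exists>w\<in>set (A # (P @ Q) # ws). d \<subseteq> set w"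
      proof (cases "w \<in> set ws")
        case False
        then have "d \<subseteq> set ?W" using w by simp
        then show ?thesis using inW[OF d] by auto
      qed (use w in auto)
    next
      fix w d e assume *: "w \<in> set (A # (P @ Q) # ws)" "d \<in> C" "e \<in> C" "d \<subseteq> set w" "e \<subseteq> set w" "d \<noteq> e"
      have "\<exists>w'\<in>set (?W # ws). set w \<subseteq> set w'"
      proof (cases "w \<in> set ws")
        case False
        then have "set w \<subseteq> set ?W" using *(1) by auto
        then show ?thesis by simp
      qed auto
      then show "\<not> chords_intersect d e"
        using planarD(2)[OF pl _ insertI2 insertI2] * by (meson subset_trans)
    qed
  next
    assume pl: "planar C (A # (P @ Q) # ws)"
    have inW: "d \<subseteq> set A \<or> d \<subseteq> set (P @ Q)" if d: "d \<in> C" "d \<subseteq> set ?W" for d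
    proof -
      obtain w where w: "w \<in> set (A # (P @ Q) # ws)" "d \<subseteq> set w" using planarD(1)[OF pl d(1)] by blast
      moreover have "w \<notin> set ws" using disj[of w] d chordC(3)[OF d(1)] w(2) by blast
      ultimately show ?thesis by auto
    qed
    have non: "\<not> chords_intersect d e"
      if d: "d \<in> C" "d \<subseteq> set ?W" and e: "e \<in> C" "e \<subseteq> set ?W" and "d \<noteq> e" for d e
    proof -
      have 1: "\<not> chords_intersect d e" if "d \<subseteq> set w" "e \<subseteq> set w" "w \<in> {A, P @ Q}" for w
        using that(3) by (intro planarD(2)[OF pl _ d(1) e(1) that(1,2) \<open>d \<noteq> e\<close>]) auto
      have 2: "\<not> chords_intersect d' e'" if "d' \<in> C" "e' \<in> C" "d' \<subseteq> set A" "e' \<subseteq> set (P @ Q)" for d' e'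
        using chordC(1) that(1,2) subset_trans[OF that(3) A] PQ that(4) lh(1)
        by (intro chords_inside_outside[of _ _ l h]) blast+
      consider "d \<subseteq> set A" "e \<subseteq> set A" | "d \<subseteq> set (P @ Q)" "e \<subseteq> set (P @ Q)"
        | "d \<subseteq> set A" "e \<subseteq> set (P @ Q)" | "e \<subseteq> set A" "d \<subseteq> set (P @ Q)"
        using inW[OF d] inW[OF e] by blast
      then show ?thesis
        using 1[of A] 1[of "P @ Q"] 2[OF d(1) e(1)] 2[OF e(1) d(1)]
          chords_intersect_commute[of d e] by cases simp_all
    qed
    have cd: "\<not> chords_intersect ?c d" if "d \<in> C" "d \<subseteq> set ?W" for d
      using split[OF that] inW[OF that] by blast
    show "planar (insert ?c C) (?W # ws)"
    proof (rule planarI)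
      fix d assume d: "d \<in> insert ?c C"
      show "\<exists>w\<in>set (?W # ws). d \<subseteq> set w"
      proof (cases "d = ?c")
        case False
        then obtain w where w: "w \<in> set (A # (P @ Q) # ws)" "d \<subseteq> set w" using planarD(1)[OF pl] d by blast
        show ?thesis
        proof (cases "w \<in> set ws")
          case False
          then have "set w \<subseteq> set ?W" using w(1) by auto
          then have "d \<subseteq> set ?W" using w(2) by blast
          then show ?thesis by simp
        qed (use w in auto)
      qed auto
    next
      fix w d e assume *: "w \<in> set (?W # ws)" "d \<in> insert ?c C" "e \<in> insert ?c C" "d \<subseteq> set w" "e \<subseteq> set w" "d \<noteq> e"
      show "\<not> chords_intersect d e"
      proof (cases "w \<in> set ws")
        case True
        then have "\<not> ?c \<subseteq> set w" using disj[of w] by auto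
        then have "d \<in> C" "e \<in> C" using * by blast+
        then show ?thesis using planarD(2)[OF pl _ _ _ *(4-6)] True by simp
      next
        case False
        then have "w = ?W" using *(1) by simp
        then consider "d = ?c" "e \<in> C" "e \<subseteq> set ?W" | "e = ?c" "d \<in> C" "d \<subseteq> set ?W"
          | "d \<in> C" "d \<subseteq> set ?W" "e \<in> C" "e \<subseteq> set ?W"
          using * by (metis insertE)
        then show ?thesis
        proof cases
          case 1
          then show ?thesis using cd by blast
        next
          case 2
          then show ?thesis using cd chords_intersect_commute[of d e] by blast
        next
          case 3
          then show ?thesis using non *(6) by blast
        qed
      qed
    qed
  qed
qed

section \<open>The power of the matrix size carried by a system of words\<close>

lemma word_traces_mset: "mset ws = mset ws' \<Longrightarrow> word_traces n ws g = word_traces n ws' g"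
  unfolding word_traces_def prod_mset_prod_list[symmetric] by simp

text \<open>
  The exponent is the number of words that are left when all chords have been contracted. Each
  contraction changes the number of words by one, upwards for a fission; a fusion therefore loses two
  against the bound. That fissions alone suffice is equivalent to planarity because both notions are
  inherited by the system that remains after one fission.
\<close>

theorem contract_word_traces:
  assumes "chord_set C" "distinct (concat ws)" "set (concat ws) = \<Union>C"
  shows "\<exists>f \<le> card C + length ws.
    ((\<forall>w\<in>set ws. monotone_word w) \<longrightarrow> (f = card C + length ws \<longleftrightarrow> planar C ws)) \<and>
    (\<forall>n (g :: nat \<Rightarrow> 'a::comm_ring_1 mat).
      contract (indices n) (unit_mat n) (\<lambda>p. unit_mat n (prod.swap p)) C g (word_traces n ws) = of_nat n ^ f)"
proof -
  have "finite C" using assms(1) by (simp add: chord_set_def)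
  then show ?thesis using assms
  proof (induction C arbitrary: ws)
    case empty
    then have empty_words: "\<And>w. w \<in> set ws \<Longrightarrow> w = []" by auto
    have "word_traces n ws g = of_nat n ^ length ws" for n and g :: "nat \<Rightarrow> 'a mat"
      unfolding word_traces_def using empty_words
    proof (induction ws)
      case (Cons w ws)
      then have "w = []" by simp
      moreover have "word_traces n ws g = of_nat n ^ length ws"
        using Cons by (simp add: word_traces_def)
      ultimately show ?case by (simp add: mat_trace_def word_traces_def)
    qed simp
    moreover have "planar {} ws" by (simp add: planar_def pairwise_nonintersecting_def)
    ultimately show ?case by (intro exI[of _ "length ws"]) (simp add: contract_empty)
  next
    case (insert c C)
    note ins = insert.prems(1) insert.hyps(2)
    have C: "chord_set C" by (rule chord_set_insertD(1)[OF ins])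
    have cC: "c \<inter> \<Union>C = {}" by (rule chord_set_insertD(2)[OF ins])
    have card: "card (insert c C) = Suc (card C)" using insert.hyps by simp
    obtain a b where ab: "c = {a, b}" "a < b" and ends: "Min c = a" "Max c = b"
      using that[OF chord_eq_Min_Max[OF chord_set_insertD(3)[OF ins]] refl refl] .
    let ?T = "\<lambda>n ws (g :: nat \<Rightarrow> 'a mat) C.
      contract (indices n) (unit_mat n) (\<lambda>p. unit_mat n (prod.swap p)) C g (word_traces n ws)"
    \<comment> \<open>Contracting one chord first trades the words for others without its endpoints. The tensor of
      matrix units is symmetric, so the chord may be entered at either endpoint.\<close>
    have reduce: "?T n us g (insert c C) = ?T n vs g C"
      if xy: "c = {x, y}"
        and vs: "set (concat vs) = \<Union>C"
        and red: "\<And>h :: nat \<Rightarrow> 'a mat. (\<And>i. i \<in> \<Union>C \<Longrightarrow> h i \<in> carrier_mat n n) \<Longrightarrow>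
          (\<Sum>p\<in>indices n. word_traces n us (h(x := unit_mat n p, y := unit_mat n (prod.swap p))))
            = word_traces n vs h"
      for us vs g n x y
      unfolding contract_insert_inner[OF ins]
    proof (rule contract_cong[OF C, where M = "carrier_mat n n"])
      fix h :: "nat \<Rightarrow> 'a mat"
      assume h: "\<And>i. i \<in> \<Union>C \<Longrightarrow> h i \<in> carrier_mat n n"
      consider "x = a" "y = b" | "x = b" "y = a" using xy ab by (auto simp: doubleton_eq_iff)
      then show "(\<Sum>t\<in>indices n. word_traces n us (h(Min c := unit_mat n t, Max c := unit_mat n (prod.swap t))))
        = word_traces n vs h"
      proof cases
        case 1
        then show ?thesis using red[OF h] ends by simp
      next
        case 2
        have "(\<Sum>t\<in>indices n. word_traces n us (h(a := unit_mat n t, b := unit_mat n (prod.swap t)))) =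
          (\<Sum>t\<in>indices n. word_traces n us (h(a := unit_mat n (prod.swap t), b := unit_mat n (prod.swap (prod.swap t)))))"
          by (rule sum_indices_swap[symmetric])
        also have "\<dots> = (\<Sum>t\<in>indices n. word_traces n us (h(b := unit_mat n t, a := unit_mat n (prod.swap t))))"
          using ab(2) by (intro sum.cong refl arg_cong[where f = "word_traces n us"]) (auto simp: fun_eq_iff)
        finally show ?thesis using red[OF h] ends 2 by simp
      qed
    qed auto
    obtain W where W: "W \<in> set ws" "a \<in> set W"
      using insert.prems(3) ab(1) by auto
    \<comment> \<open>The statement depends on the words only through their multiset, so the word that contains one end
      of the chord is moved to the front.\<close>
    define rest where "rest = remove1 W ws"
    have ws: "mset ws = mset (W # rest)" using W by (simp add: rest_def)
    show ?case
    proof (cases "b \<in> set W")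
      case True
      obtain x y P A Q where xy: "c = {x, y}" and Weq: "W = P @ x # A @ y # Q"
      proof -
        obtain U V where UV: "W = U @ a # V" using W(2) by (auto dest: split_list)
        then have "b \<in> set U \<or> b \<in> set V" using True ab(2) by auto
        then show thesis
        proof
          assume "b \<in> set U"
          then obtain U1 U2 where "U = U1 @ b # U2" by (auto dest: split_list)
          then show thesis using that[of b a U1 U2 V] UV ab(1) by auto
        next
          assume "b \<in> set V"
          then obtain V1 V2 where "V = V1 @ b # V2" by (auto dest: split_list)
          then show thesis using that[of a b U V1 V2] UV ab(1) by auto
        qed
      qed
      let ?us = "(P @ x # A @ y # Q) # rest" and ?vs = "A # (P @ Q) # rest"
      have us: "mset ws = mset ?us" using ws Weq by simp
      have "mset (concat ws) = mset (concat ?us)"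
        unfolding mset_concat using us by (metis mset_map sum_mset_sum_list)
      then have du: "distinct (concat ?us)" and su: "set (concat ?us) = \<Union>(insert c C)"
        using insert.prems(2,3) by (metis mset_eq_imp_distinct_iff, metis mset_eq_setD)
      have dv: "distinct (concat ?vs)" using du by auto
      have "set (concat ?vs) = set (concat ?us) - c" using du xy by auto
      then have sv: "set (concat ?vs) = \<Union>C" using su cC by auto
      obtain f where f: "f \<le> card C + length ?vs"
        "(\<forall>w\<in>set ?vs. monotone_word w) \<longrightarrow> (f = card C + length ?vs \<longleftrightarrow> planar C ?vs)"
        "\<forall>n g. ?T n ?vs g C = of_nat n ^ f"
        using insert.IH[OF C dv sv] by (elim exE conjE)
      have "?T n ws g (insert c C) = of_nat n ^ f" for n g
      proof -
        have "?T n ?us g (insert c C) = ?T n ?vs g C"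
        proof (rule reduce[OF xy sv])
          fix h :: "nat \<Rightarrow> 'a mat"
          assume "\<And>i. i \<in> \<Union>C \<Longrightarrow> h i \<in> carrier_mat n n"
          then show "(\<Sum>p\<in>indices n. word_traces n ?us (h(x := unit_mat n p, y := unit_mat n (prod.swap p))))
            = word_traces n ?vs h"
            using du sv[symmetric] by (intro word_traces_fission) auto
        qed
        moreover have "word_traces n ws = (word_traces n ?us :: (nat \<Rightarrow> 'a mat) \<Rightarrow> 'a)"
          by (intro ext word_traces_mset[OF us])
        ultimately show ?thesis using f(3) by simp
      qed
      moreover have "length ws = length ?us" using us by (metis size_mset)
      moreover have "f = card (insert c C) + length ws \<longleftrightarrow> planar (insert c C) ws"
        if "\<forall>w\<in>set ws. monotone_word w"
      proof -
        have setws: "set ws = set ?us" using us by (metis set_mset_mset)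
        then have m: "monotone_word (P @ x # A @ y # Q)" "\<forall>w\<in>set rest. monotone_word w" using that by auto
        have "planar (insert c C) ws \<longleftrightarrow> planar (insert c C) ?us" unfolding planar_def setws ..
        also have "\<dots> \<longleftrightarrow> planar C ?vs"
          using planar_fission[OF _ _ du m(1)] ins xy by auto
        also have "\<dots> \<longleftrightarrow> f = card C + length ?vs"
          using f(2) m(2) monotone_word_fission(3,4)[OF m(1)] du
          unfolding concat.simps distinct_append by simp
        finally show ?thesis using card \<open>length ws = length ?us\<close> by auto
      qed
      ultimately show ?thesis using f(1) card by (intro exI[of _ f]) auto
    next
      case False
      have "set ws = set (W # rest)"
        using ws by (metis set_mset_mset)
      then have "b \<in> set (concat (W # rest))"
        using insert.prems(3) ab(1) by auto
      then obtain W' where W': "W' \<in> set rest" "b \<in> set W'" using False by auto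
      define rest' where "rest' = remove1 W' rest"
      obtain P Q where PQ: "W = P @ a # Q" using W(2) by (auto dest: split_list)
      obtain R S where RS: "W' = R @ b # S" using W'(2) by (auto dest: split_list)
      let ?us = "(P @ a # Q) # (R @ b # S) # rest'" and ?vs = "(Q @ P @ S @ R) # rest'"
      have us: "mset ws = mset ?us" using ws W' PQ RS by (simp add: rest'_def)
      have "mset (concat ws) = mset (concat ?us)"
        unfolding mset_concat using us by (metis mset_map sum_mset_sum_list)
      then have du: "distinct (concat ?us)" and su: "set (concat ?us) = \<Union>(insert c C)"
        using insert.prems(2,3) by (metis mset_eq_imp_distinct_iff, metis mset_eq_setD)
      have dv: "distinct (concat ?vs)" using du by auto
      have "set (concat ?vs) = set (concat ?us) - c" using du ab(1) by auto
      then have sv: "set (concat ?vs) = \<Union>C" using su cC by auto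
      obtain f where f: "f \<le> card C + length ?vs" "\<forall>n g. ?T n ?vs g C = of_nat n ^ f"
        using insert.IH[OF C dv sv] by (elim exE conjE)
      have "?T n ws g (insert c C) = of_nat n ^ f" for n g
      proof -
        have "?T n ?us g (insert c C) = ?T n ?vs g C"
        proof (rule reduce[OF ab(1) sv])
          fix h :: "nat \<Rightarrow> 'a mat"
          assume "\<And>i. i \<in> \<Union>C \<Longrightarrow> h i \<in> carrier_mat n n"
          then show "(\<Sum>p\<in>indices n. word_traces n ?us (h(a := unit_mat n p, b := unit_mat n (prod.swap p))))
            = word_traces n ?vs h"
            using du sv[symmetric] by (intro word_traces_fusion) auto
        qed
        moreover have "word_traces n ws = (word_traces n ?us :: (nat \<Rightarrow> 'a mat) \<Rightarrow> 'a)"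
          by (intro ext word_traces_mset[OF us])
        ultimately show ?thesis using f(2) by simp
      qed
      moreover have len: "length ws = length ?us" using us by (metis size_mset)
      moreover have "\<not> planar (insert c C) ws"
      proof -
        have setws: "set ws = set ?us" using us by (metis set_mset_mset)
        have "\<not> c \<subseteq> set w" if "w \<in> set ?us" for w
          using that du ab(1,2) by auto
        then show ?thesis unfolding planar_def setws by blast
      qed
      moreover have "f < card (insert c C) + length ws" using f(1) card len by simp
      ultimately show ?thesis by (intro exI[of _ f]) auto
    qed
  qed
qed

section \<open>Linear combinations of matrices\<close>

text \<open>
  Linear combinations are expressed entrywise, because matrices of all sizes share one type and
  therefore have no sum over an index set.
\<close>

definition lin_comb :: "nat \<Rightarrow> 'a::comm_ring_1 mat \<Rightarrow> 'b set \<Rightarrow> ('b \<Rightarrow> 'a) \<Rightarrow> ('b \<Rightarrow> 'a mat) \<Rightarrow> bool" where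
  "lin_comb n X I c Z \<longleftrightarrow> X \<in> carrier_mat n n \<and> (\<forall>t\<in>I. Z t \<in> carrier_mat n n) \<and>
     (\<forall>r<n. \<forall>s<n. X $$ (r, s) = (\<Sum>t\<in>I. c t * Z t $$ (r, s)))"

lemma lin_combD:
  assumes "lin_comb n X I c Z"
  shows "X \<in> carrier_mat n n" "t \<in> I \<Longrightarrow> Z t \<in> carrier_mat n n"
    "r < n \<Longrightarrow> s < n \<Longrightarrow> X $$ (r, s) = (\<Sum>t\<in>I. c t * Z t $$ (r, s))"
  using assms by (auto simp: lin_comb_def)

lemma lin_combI:
  assumes "X \<in> carrier_mat n n" "\<And>t. t \<in> I \<Longrightarrow> Z t \<in> carrier_mat n n"
    "\<And>r s. r < n \<Longrightarrow> s < n \<Longrightarrow> X $$ (r, s) = (\<Sum>t\<in>I. c t * Z t $$ (r, s))"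
  shows "lin_comb n X I c Z"
  using assms by (auto simp: lin_comb_def)

lemma lin_comb_units:
  "X \<in> carrier_mat n n \<Longrightarrow> lin_comb n X (indices n) (\<lambda>p. X $$ p) (unit_mat n)"
proof (rule lin_combI)
  fix r s assume rs: "r < n" "s < n"
  have "(\<Sum>p\<in>indices n. X $$ p * unit_mat n p $$ (r, s)) = (\<Sum>p\<in>indices n. if p = (r, s) then X $$ p else 0)"
    using rs by (intro sum.cong) auto
  then show "X $$ (r, s) = (\<Sum>p\<in>indices n. X $$ p * unit_mat n p $$ (r, s))"
    using rs by simp
qed auto

lemma mat_trace_square: "X \<in> carrier_mat n n \<Longrightarrow> mat_trace X = (\<Sum>i<n. X $$ (i, i))"
  by (simp add: mat_trace_def)

lemma mat_trace_minus:
  fixes X Y :: "'a::comm_ring_1 mat"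
  assumes "X \<in> carrier_mat n n" "Y \<in> carrier_mat n n"
  shows "mat_trace (X - Y) = mat_trace X - mat_trace Y"
  using assms by (simp add: mat_trace_def sum_subtractf)

lemma mat_trace_smult:
  fixes X :: "'a::comm_ring_1 mat"
  assumes "X \<in> carrier_mat n n"
  shows "mat_trace (a \<cdot>\<^sub>m X) = a * mat_trace X"
  using assms by (simp add: mat_trace_def sum_distrib_left)

lemma mat_trace_lin_comb:
  assumes "lin_comb n X I c Z"
  shows "mat_trace X = (\<Sum>t\<in>I. c t * mat_trace (Z t))"
proof -
  have "mat_trace X = (\<Sum>i<n. \<Sum>t\<in>I. c t * Z t $$ (i, i))"
    using lin_combD[OF assms] by (simp add: mat_trace_square)
  also have "\<dots> = (\<Sum>t\<in>I. \<Sum>i<n. c t * Z t $$ (i, i))"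
    by (rule sum.swap)
  also have "\<dots> = (\<Sum>t\<in>I. c t * mat_trace (Z t))"
    using lin_combD(2)[OF assms] by (intro sum.cong refl) (simp add: mat_trace_square[where n = n] sum_distrib_left)
  finally show ?thesis .
qed

lemma lin_comb_mult_left:
  assumes "lin_comb n X I c Z" "A \<in> carrier_mat n n"
  shows "lin_comb n (A * X) I c (\<lambda>t. A * Z t)"
proof (rule lin_combI)
  fix r s assume rs: "r < n" "s < n"
  have "(A * X) $$ (r, s) = (\<Sum>u<n. \<Sum>t\<in>I. c t * (A $$ (r, u) * Z t $$ (u, s)))"
    using assms lin_combD(1,3)[OF assms(1)] rs
    by (subst mat_mult_index[where n = n]) (auto simp: sum_distrib_left algebra_simps)
  also have "\<dots> = (\<Sum>t\<in>I. \<Sum>u<n. c t * (A $$ (r, u) * Z t $$ (u, s)))"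
    by (rule sum.swap)
  also have "\<dots> = (\<Sum>t\<in>I. c t * (A * Z t) $$ (r, s))"
  proof (intro sum.cong refl)
    fix t assume "t \<in> I"
    then show "(\<Sum>u<n. c t * (A $$ (r, u) * Z t $$ (u, s))) = c t * (A * Z t) $$ (r, s)"
      using assms lin_combD(2)[OF assms(1)] rs
      by (subst mat_mult_index[where n = n]) (auto simp: sum_distrib_left)
  qed
  finally show "(A * X) $$ (r, s) = (\<Sum>t\<in>I. c t * (A * Z t) $$ (r, s))" .
qed (use assms lin_combD[OF assms(1)] in simp_all)

lemma lin_comb_mult_right:
  assumes "lin_comb n X I c Z" "A \<in> carrier_mat n n"
  shows "lin_comb n (X * A) I c (\<lambda>t. Z t * A)"
proof (rule lin_combI)
  fix r s assume rs: "r < n" "s < n"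
  have "(X * A) $$ (r, s) = (\<Sum>u<n. \<Sum>t\<in>I. c t * (Z t $$ (r, u) * A $$ (u, s)))"
    using assms lin_combD(1,3)[OF assms(1)] rs
    by (subst mat_mult_index[where n = n]) (auto simp: sum_distrib_right sum_distrib_left algebra_simps)
  also have "\<dots> = (\<Sum>t\<in>I. \<Sum>u<n. c t * (Z t $$ (r, u) * A $$ (u, s)))"
    by (rule sum.swap)
  also have "\<dots> = (\<Sum>t\<in>I. c t * (Z t * A) $$ (r, s))"
  proof (intro sum.cong refl)
    fix t assume "t \<in> I"
    then show "(\<Sum>u<n. c t * (Z t $$ (r, u) * A $$ (u, s))) = c t * (Z t * A) $$ (r, s)"
      using assms lin_combD(2)[OF assms(1)] rs
      by (subst mat_mult_index[where n = n]) (auto simp: sum_distrib_left)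
  qed
  finally show "(X * A) $$ (r, s) = (\<Sum>t\<in>I. c t * (Z t * A) $$ (r, s))" .
qed (use assms lin_combD[OF assms(1)] in simp_all)

lemma lin_comb_minus:
  assumes "lin_comb n X I c Z" "lin_comb n X' I c Z'"
  shows "lin_comb n (X - X') I c (\<lambda>t. Z t - Z' t)"
proof (rule lin_combI)
  fix r s assume rs: "r < n" "s < n"
  have "(\<Sum>t\<in>I. c t * (Z t - Z' t) $$ (r, s)) = (\<Sum>t\<in>I. c t * Z t $$ (r, s) - c t * Z' t $$ (r, s))"
  proof (intro sum.cong refl)
    fix t assume "t \<in> I"
    then show "c t * (Z t - Z' t) $$ (r, s) = c t * Z t $$ (r, s) - c t * Z' t $$ (r, s)"
      using rs lin_combD(2)[OF assms(1)] lin_combD(2)[OF assms(2)]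
      by (simp add: carrier_matD[of _ n n] right_diff_distrib)
  qed
  also have "\<dots> = (X - X') $$ (r, s)"
    using lin_combD[OF assms(1)] lin_combD[OF assms(2)] rs by (simp add: sum_subtractf)
  finally show "(X - X') $$ (r, s) = (\<Sum>t\<in>I. c t * (Z t - Z' t) $$ (r, s))" ..
qed (use lin_combD(1,2)[OF assms(1)] lin_combD(1,2)[OF assms(2)] in \<open>simp_all add: minus_carrier_mat\<close>)

section \<open>Products of adjoint operators\<close>

lemma ad_carrier [simp]:
  "x \<in> carrier_mat n n \<Longrightarrow> y \<in> carrier_mat n n \<Longrightarrow> ad x y \<in> carrier_mat n n"
  by (simp add: ad_def minus_carrier_mat)

lemma lin_comb_ad_right:
  "lin_comb n X I c Z \<Longrightarrow> x \<in> carrier_mat n n \<Longrightarrow> lin_comb n (ad x X) I c (\<lambda>t. ad x (Z t))"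
  unfolding ad_def by (intro lin_comb_minus lin_comb_mult_left lin_comb_mult_right)

lemma lin_comb_ad_left:
  "lin_comb n X I c Z \<Longrightarrow> y \<in> carrier_mat n n \<Longrightarrow> lin_comb n (ad X y) I c (\<lambda>t. ad (Z t) y)"
  unfolding ad_def by (intro lin_comb_minus lin_comb_mult_left lin_comb_mult_right)

lemma mat_trace_ad:
  fixes x y :: "'a::comm_ring_1 mat"
  assumes "x \<in> carrier_mat n n" "y \<in> carrier_mat n n"
  shows "mat_trace (ad x y) = 0"
proof -
  have "mat_trace (ad x y) = mat_trace (x * y) - mat_trace (y * x)"
    using assms by (simp add: ad_def mat_trace_def sum_subtractf)
  then show ?thesis using mat_trace_comm[OF assms] by simp
qed

abbreviation ad_prod :: "'a::comm_ring_1 mat list \<Rightarrow> 'a mat \<Rightarrow> 'a mat" where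
  "ad_prod xs \<equiv> foldr (\<lambda>x T. ad x \<circ> T) xs id"

lemma ad_prod_append: "ad_prod (xs @ ys) y = ad_prod xs (ad_prod ys y)"
  by (induction xs) auto

lemma ad_prod_carrier:
  "set xs \<subseteq> carrier_mat n n \<Longrightarrow> y \<in> carrier_mat n n \<Longrightarrow> ad_prod xs y \<in> carrier_mat n n"
  by (induction xs) auto

lemma lin_comb_ad_prod:
  "set xs \<subseteq> carrier_mat n n \<Longrightarrow> lin_comb n X I c Z \<Longrightarrow>
    lin_comb n (ad_prod xs X) I c (\<lambda>t. ad_prod xs (Z t))"
  by (induction xs) (auto intro: lin_comb_ad_right)

lemma sum_Pow_insert:
  assumes "finite A" "p \<notin> A"
  shows "(\<Sum>S\<in>Pow (insert p A). F S) = (\<Sum>S\<in>Pow A. F (insert p S) + F S)"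
proof -
  have "inj_on (insert p) (Pow A)" using assms(2) by (auto simp: inj_on_def)
  moreover have "Pow A \<inter> insert p ` Pow A = {}" using assms(2) by auto
  ultimately show ?thesis
    using assms(1) by (simp add: Pow_insert sum.union_disjoint sum.reindex sum.distrib add.commute)
qed

text \<open>
  Each \<open>ad x\<close> is left minus right multiplication by \<open>x\<close>. The factors acting from the left keep
  their order, those acting from the right appear in reverse order.
\<close>

lemma lin_comb_ad_prod_words:
  fixes g :: "nat \<Rightarrow> 'a::comm_ring_1 mat"
  assumes "distinct ps" "\<And>i. i \<in> set ps \<Longrightarrow> g i \<in> carrier_mat n n" "Y \<in> carrier_mat n n"
  shows "lin_comb n (ad_prod (map g ps) Y) (Pow (set ps)) (\<lambda>S. (- 1) ^ card (set ps - S))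
    (\<lambda>S. mat_prod n (map g (filter (\<lambda>i. i \<in> S) ps)) * (Y * mat_prod n (map g (rev (filter (\<lambda>i. i \<notin> S) ps)))))"
  using assms(1,2)
proof (induction ps)
  case Nil
  then show ?case using assms(3) by (auto simp: lin_comb_def)
next
  case (Cons p ps)
  let ?L = "\<lambda>ps S. mat_prod n (map g (filter (\<lambda>i. i \<in> S) ps))"
  let ?R = "\<lambda>ps S. mat_prod n (map g (rev (filter (\<lambda>i. i \<notin> S) ps)))"
  let ?Z = "\<lambda>ps S. ?L ps S * (Y * ?R ps S)"
  have p: "p \<notin> set ps" "g p \<in> carrier_mat n n" using Cons.prems by auto
  have LR: "?L ps S \<in> carrier_mat n n" "?R ps S \<in> carrier_mat n n" for S
    using Cons.prems(2) by (auto intro!: mat_prod_carrier)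
  have lc: "lin_comb n (ad (g p) (ad_prod (map g ps) Y)) (Pow (set ps)) (\<lambda>S. (- 1) ^ card (set ps - S))
     (\<lambda>S. ad (g p) (?Z ps S))"
    using Cons p(2) by (intro lin_comb_ad_right Cons.IH) auto
  show ?case
  proof (rule lin_combI)
    show "ad_prod (map g (p # ps)) Y \<in> carrier_mat n n"
      using lin_combD(1)[OF lc] by simp
    show "?Z (p # ps) S \<in> carrier_mat n n" for S
      using Cons.prems(2) assms(3)
      by (intro square_mat_mult_carrier mat_prod_carrier) (auto split: if_splits)
    fix r s assume rs: "r < n" "s < n"
    have with_p: "?Z (p # ps) (insert p S) = g p * ?Z ps S" if "S \<subseteq> set ps" for S
    proof -
      have "filter (\<lambda>i. i \<in> insert p S) (p # ps) = p # filter (\<lambda>i. i \<in> S) ps"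
        "filter (\<lambda>i. i \<notin> insert p S) (p # ps) = filter (\<lambda>i. i \<notin> S) ps"
        using p(1) by (auto intro!: filter_cong)
      then show ?thesis
        using LR[of S] p(2) assms(3) by (simp add: square_mat_assoc[where n = n] del: filter.simps)
    qed
    have without_p: "?Z (p # ps) S = ?Z ps S * g p" if "S \<subseteq> set ps" for S
    proof -
      have "p \<notin> S" using that p(1) by auto
      moreover have "mat_prod n (map g (rev (filter (\<lambda>i. i \<notin> S) ps)) @ [g p]) = ?R ps S * mat_prod n [g p]"
        using Cons.prems(2) by (intro mat_prod_append) auto
      ultimately have "?R (p # ps) S = ?R ps S * g p" "?L (p # ps) S = ?L ps S"
        using p(2) by simp_all
      then show ?thesis
        using LR[of S] p(2) assms(3) by (simp only: square_mat_assoc[where n = n] square_mat_mult_carrier)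
    qed
    have "(\<Sum>S\<in>Pow (set (p # ps)). (- 1) ^ card (set (p # ps) - S) * ?Z (p # ps) S $$ (r, s))
      = (\<Sum>S\<in>Pow (set ps). (- 1) ^ card (set ps - S) * (g p * ?Z ps S) $$ (r, s)
          - (- 1) ^ card (set ps - S) * (?Z ps S * g p) $$ (r, s))"
    proof (simp only: list.set sum_Pow_insert[OF finite_set p(1)], intro sum.cong refl)
      fix S assume S: "S \<in> Pow (set ps)"
      have "insert p (set ps) - insert p S = set ps - S" using p(1) by auto
      moreover have "insert p (set ps) - S = insert p (set ps - S)" using p(1) S by auto
      then have "card (insert p (set ps) - S) = Suc (card (set ps - S))" using p(1) by simp
      ultimately show "(- 1) ^ card (insert p (set ps) - insert p S) * ?Z (p # ps) (insert p S) $$ (r, s) +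
          (- 1) ^ card (insert p (set ps) - S) * ?Z (p # ps) S $$ (r, s)
        = (- 1) ^ card (set ps - S) * (g p * ?Z ps S) $$ (r, s)
          - (- 1) ^ card (set ps - S) * (?Z ps S * g p) $$ (r, s)"
        using with_p[of S] without_p[of S] S by (simp only: Pow_iff power_Suc) simp
    qed
    also have "\<dots> = (\<Sum>S\<in>Pow (set ps). (- 1) ^ card (set ps - S) * ad (g p) (?Z ps S) $$ (r, s))"
    proof (intro sum.cong refl)
      fix S
      have "ad (g p) (?Z ps S) $$ (r, s) = (g p * ?Z ps S) $$ (r, s) - (?Z ps S * g p) $$ (r, s)"
        unfolding ad_def using LR[of S] p(2) assms(3) rs by (intro index_minus_mat) auto
      then show "(- 1) ^ card (set ps - S) * (g p * ?Z ps S) $$ (r, s)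
          - (- 1) ^ card (set ps - S) * (?Z ps S * g p) $$ (r, s) =
        (- 1) ^ card (set ps - S) * ad (g p) (?Z ps S) $$ (r, s)"
        by (simp only: right_diff_distrib)
    qed
    also have "\<dots> = ad_prod (map g (p # ps)) Y $$ (r, s)"
      using lin_combD(3)[OF lc rs] by simp
    finally show "ad_prod (map g (p # ps)) Y $$ (r, s) =
      (\<Sum>S\<in>Pow (set (p # ps)). (- 1) ^ card (set (p # ps) - S) * ?Z (p # ps) S $$ (r, s))" ..
  qed
qed

text \<open>
  The trace of \<open>Y \<mapsto> A * Y * B\<close>, as an operator on all matrices.
\<close>

lemma sum_diagonal_left_right_mult:
  fixes A B :: "'a::comm_ring_1 mat"
  assumes "A \<in> carrier_mat n n" "B \<in> carrier_mat n n"
  shows "(\<Sum>p\<in>indices n. (A * (unit_mat n p * B)) $$ p) = mat_trace A * mat_trace B"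
proof -
  have "(A * (unit_mat n (i, j) * B)) $$ (i, j) = A $$ (i, i) * B $$ (j, j)" if "i < n" "j < n" for i j
  proof -
    have "(A * (unit_mat n (i, j) * B)) $$ (i, j) = (\<Sum>t<n. A $$ (i, t) * (unit_mat n (i, j) * B) $$ (t, j))"
      using assms that by (intro mat_mult_index) simp_all
    also have "\<dots> = (\<Sum>t<n. if t = i then A $$ (i, t) * B $$ (j, j) else 0)"
      using assms that
      by (intro sum.cong refl) (simp add: unit_mat_mult_index[where n = n] del: index_mult_mat(1))
    finally show ?thesis using that by simp
  qed
  then show ?thesis
    using assms by (simp add: sum_indices mat_trace_square sum_product del: index_mult_mat(1))
qed

lemma sum_diagonal_ad_prod:
  fixes g :: "nat \<Rightarrow> 'a::comm_ring_1 mat"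
  assumes "distinct ps" "\<And>i. i \<in> set ps \<Longrightarrow> g i \<in> carrier_mat n n"
  shows "(\<Sum>p\<in>indices n. ad_prod (map g ps) (unit_mat n p) $$ p) =
    (\<Sum>S\<in>Pow (set ps). (- 1) ^ card (set ps - S) *
      word_traces n [filter (\<lambda>i. i \<in> S) ps, rev (filter (\<lambda>i. i \<notin> S) ps)] g)"
proof -
  let ?L = "\<lambda>S. mat_prod n (map g (filter (\<lambda>i. i \<in> S) ps))"
  let ?R = "\<lambda>S. mat_prod n (map g (rev (filter (\<lambda>i. i \<notin> S) ps)))"
  have "(\<Sum>p\<in>indices n. ad_prod (map g ps) (unit_mat n p) $$ p) =
    (\<Sum>p\<in>indices n. \<Sum>S\<in>Pow (set ps). (- 1) ^ card (set ps - S) * (?L S * (unit_mat n p * ?R S)) $$ p)"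
    using lin_combD(3)[OF lin_comb_ad_prod_words[OF assms unit_mat_carrier]]
    by (intro sum.cong refl) (auto simp del: index_mult_mat(1))
  also have "\<dots> = (\<Sum>S\<in>Pow (set ps). \<Sum>p\<in>indices n. (- 1) ^ card (set ps - S) * (?L S * (unit_mat n p * ?R S)) $$ p)"
    by (rule sum.swap)
  also have "\<dots> = (\<Sum>S\<in>Pow (set ps). (- 1) ^ card (set ps - S) * (mat_trace (?L S) * mat_trace (?R S)))"
  proof (intro sum.cong refl)
    fix S
    have LR: "?L S \<in> carrier_mat n n" "?R S \<in> carrier_mat n n"
      using assms(2) by (auto intro!: mat_prod_carrier)
    show "(\<Sum>p\<in>indices n. (- 1) ^ card (set ps - S) * (?L S * (unit_mat n p * ?R S)) $$ p) =
      (- 1) ^ card (set ps - S) * (mat_trace (?L S) * mat_trace (?R S))"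
      unfolding sum_diagonal_left_right_mult[OF LR, symmetric] by (rule sum_distrib_left[symmetric])
  qed
  finally show ?thesis by (simp add: word_traces_def)
qed

section \<open>Traces of operators on traceless matrices\<close>

lemma sl_simps:
  "carrier (sl n :: ('a::field, 'a mat) module) = {A \<in> carrier_mat n n. mat_trace A = 0}"
  "add (sl n :: ('a, 'a mat) module) = (+)"
  "zero (sl n :: ('a, 'a mat) module) = 0\<^sub>m n n"
  "module.smult (sl n :: ('a, 'a mat) module) = (\<cdot>\<^sub>m)"
  by (simp_all add: sl_def module_mat_simps)

lemma lin_comb_lincomb:
  fixes B :: "'a::field mat set"
  assumes "B \<subseteq> carrier (sl n)" "finite B"
  shows "lin_comb n (module.lincomb (sl n) a B) B a (\<lambda>b. b)" "module.lincomb (sl n) a B \<in> carrier (sl n)"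
proof -
  interpret V: vectorspace class_ring "sl n :: ('a, 'a mat) module" by (rule vectorspace_sl)
  have sum: "finsum (sl n) (\<lambda>b. a b \<cdot>\<^sub>m b) B \<in> carrier (sl n) \<and>
    (\<forall>r<n. \<forall>s<n. finsum (sl n) (\<lambda>b. a b \<cdot>\<^sub>m b) B $$ (r, s) = (\<Sum>b\<in>B. a b * b $$ (r, s)))"
    using assms(2,1)
  proof (induction B)
    case empty
    then show ?case by (simp add: sl_simps mat_trace_def)
  next
    case (insert b B)
    have c: "a x \<cdot>\<^sub>m x \<in> carrier (sl n)" if "x \<in> insert b B" for x
      using that insert.prems V.smult_closed[of "a x" x] by (auto simp: sl_simps class_ring_simps)
    have "finsum (sl n) (\<lambda>b. a b \<cdot>\<^sub>m b) (insert b B) = a b \<cdot>\<^sub>m b + finsum (sl n) (\<lambda>b. a b \<cdot>\<^sub>m b) B"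
      using insert.hyps c by (subst V.M.finsum_insert) (auto simp: sl_simps(2))
    moreover have "a b \<cdot>\<^sub>m b + finsum (sl n) (\<lambda>b. a b \<cdot>\<^sub>m b) B \<in> carrier (sl n)"
      using V.M.a_closed[OF c[of b], of "finsum (sl n) (\<lambda>b. a b \<cdot>\<^sub>m b) B"] insert
      by (simp add: sl_simps(2))
    moreover have "(a b \<cdot>\<^sub>m b + finsum (sl n) (\<lambda>b. a b \<cdot>\<^sub>m b) B) $$ (r, s) = a b * b $$ (r, s) + (\<Sum>b\<in>B. a b * b $$ (r, s))"
      if "r < n" "s < n" for r s
      using insert that by (auto simp: sl_simps(1))
    ultimately show ?case using insert.hyps by auto
  qed
  then show "lin_comb n (module.lincomb (sl n) a B) B a (\<lambda>b. b)" "module.lincomb (sl n) a B \<in> carrier (sl n)"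
    using assms(1) unfolding V.lincomb_def by (auto simp: lin_comb_def sl_simps)
qed

lemma lincomb_sl_eq_iff:
  fixes B :: "'a::field mat set"
  assumes "B \<subseteq> carrier (sl n)" "finite B" "v \<in> carrier (sl n)"
  shows "module.lincomb (sl n) a B = v \<longleftrightarrow> lin_comb n v B a (\<lambda>b. b)"
proof
  assume "lin_comb n v B a (\<lambda>b. b)"
  then show "module.lincomb (sl n) a B = v"
    using lin_combD(1,3)[OF lin_comb_lincomb(1)[OF assms(1,2), of a]] lin_combD(1,3)[of n v B a "\<lambda>b. b"]
    by (intro eq_matI) auto
qed (use lin_comb_lincomb(1)[OF assms(1,2)] in auto)

lemma basis_sl_iff:
  fixes B :: "'a::field mat set"
  assumes "finite B" "B \<subseteq> carrier (sl n)"
  shows "vectorspace.basis class_ring (sl n) B \<longleftrightarrow>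
    (\<forall>v\<in>carrier (sl n). \<exists>!a. a \<in> B \<rightarrow>\<^sub>E UNIV \<and> lin_comb n v B a (\<lambda>b. b))"
proof -
  interpret V: vectorspace class_ring "sl n :: ('a, 'a mat) module" by (rule vectorspace_sl)
  show ?thesis
    unfolding V.basis_criterion[OF assms] Ball_def class_ring_simps
  proof (intro all_cong1 imp_cong refl)
    fix v assume "v \<in> carrier (sl n :: ('a, 'a mat) module)"
    then show "(\<exists>!a. a \<in> B \<rightarrow>\<^sub>E UNIV \<and> V.lincomb a B = v) \<longleftrightarrow> (\<exists>!a. a \<in> B \<rightarrow>\<^sub>E UNIV \<and> lin_comb n v B a (\<lambda>b. b))"
      by (simp only: lincomb_sl_eq_iff[OF assms(2,1)])
  qed
qed

context
  fixes n :: nat and B :: "'a::field mat set"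
  assumes fin: "finite B" and basis: "vectorspace.basis class_ring (sl n) B"
begin

lemma basis_sl_carrier: "B \<subseteq> carrier (sl n)"
  using basis vectorspace.basis_def[OF vectorspace_sl[where 'a = 'a]] by blast

lemma coords_sl:
  assumes "v \<in> carrier (sl n)"
  shows "lin_comb n v B (vectorspace.coords class_ring (sl n) B v) (\<lambda>b. b)"
    and "lin_comb n v B a (\<lambda>b. b) \<Longrightarrow> b \<in> B \<Longrightarrow> vectorspace.coords class_ring (sl n) B v b = a b"
proof -
  interpret V: vectorspace class_ring "sl n :: ('a, 'a mat) module" by (rule vectorspace_sl)
  have ex1: "\<exists>!a. a \<in> B \<rightarrow>\<^sub>E UNIV \<and> lin_comb n v B a (\<lambda>b. b)"
    using basis assms basis_sl_iff[OF fin basis_sl_carrier] by blast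
  have "V.coords B v = (THE a. a \<in> B \<rightarrow>\<^sub>E UNIV \<and> lin_comb n v B a (\<lambda>b. b))"
    unfolding V.coords_def using lincomb_sl_eq_iff[OF basis_sl_carrier fin assms] by (simp add: class_ring_simps)
  then have the: "V.coords B v \<in> B \<rightarrow>\<^sub>E UNIV \<and> lin_comb n v B (V.coords B v) (\<lambda>b. b)"
    using theI'[OF ex1] by simp
  then show "lin_comb n v B (V.coords B v) (\<lambda>b. b)" by simp
  assume a: "lin_comb n v B a (\<lambda>b. b)" and b: "b \<in> B"
  have "lin_comb n v B (restrict a B) (\<lambda>b. b)" using a by (simp add: lin_comb_def)
  then have "V.coords B v = restrict a B" using ex1 the by (metis restrict_PiE_iff UNIV_I)
  then show "V.coords B v b = a b" using b by simp
qed

lemma coords_sl_lin_comb: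
  assumes "lin_comb n X I c Z" "X \<in> carrier (sl n)" "\<And>t. t \<in> I \<Longrightarrow> Z t \<in> carrier (sl n)" "b \<in> B"
  shows "vectorspace.coords class_ring (sl n) B X b =
    (\<Sum>t\<in>I. c t * vectorspace.coords class_ring (sl n) B (Z t) b)"
proof (rule coords_sl(2)[OF assms(2) _ assms(4)], rule lin_combI)
  fix r s assume rs: "r < n" "s < n"
  have "X $$ (r, s) = (\<Sum>t\<in>I. \<Sum>b\<in>B. c t * (vectorspace.coords class_ring (sl n) B (Z t) b * b $$ (r, s)))"
    unfolding lin_combD(3)[OF assms(1) rs] sum_distrib_left[symmetric]
    using lin_combD(3)[OF coords_sl(1)[OF assms(3)] rs] by (intro sum.cong refl) simp
  also have "\<dots> = (\<Sum>b\<in>B. (\<Sum>t\<in>I. c t * vectorspace.coords class_ring (sl n) B (Z t) b) * b $$ (r, s))"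
    by (subst sum.swap) (simp add: sum_distrib_right mult.assoc)
  finally show "X $$ (r, s) = \<dots>" .
qed (use assms basis_sl_carrier in \<open>auto simp: sl_simps\<close>)

text \<open>
  An operator on all matrices with traceless values induces zero on the quotient by the traceless ones,
  so it has the same trace on the subspace as on the whole space. In coordinates, the entries of the
  basis elements sum up to those of \<open>T (unit_mat n p)\<close>.
\<close>

lemma sum_coords_sl:
  assumes lin: "\<And>X. X \<in> carrier_mat n n \<Longrightarrow>
      lin_comb n (T X) (indices n) (\<lambda>p. X $$ p) (\<lambda>p. T (unit_mat n p))"
    and T: "\<And>X. X \<in> carrier_mat n n \<Longrightarrow> mat_trace (T X) = 0"
  shows "(\<Sum>b\<in>B. vectorspace.coords class_ring (sl n) B (T b) b) = (\<Sum>p\<in>indices n. T (unit_mat n p) $$ p)"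
proof -
  let ?co = "vectorspace.coords class_ring (sl n) B"
  have Tsl: "T X \<in> carrier (sl n)" if "X \<in> carrier_mat n n" for X
    using lin_combD(1)[OF lin[OF that]] T[OF that] by (simp add: sl_simps)
  have "(\<Sum>b\<in>B. ?co (T b) b) = (\<Sum>b\<in>B. \<Sum>p\<in>indices n. b $$ p * ?co (T (unit_mat n p)) b)"
    using basis_sl_carrier by (intro sum.cong refl coords_sl_lin_comb[OF lin] Tsl) (auto simp: sl_simps)
  also have "\<dots> = (\<Sum>p\<in>indices n. \<Sum>b\<in>B. b $$ p * ?co (T (unit_mat n p)) b)"
    by (rule sum.swap)
  also have "\<dots> = (\<Sum>p\<in>indices n. T (unit_mat n p) $$ p)"
    using lin_combD(3)[OF coords_sl(1)[OF Tsl[OF unit_mat_carrier]]]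
    by (intro sum.cong refl) (auto simp: mult.commute)
  finally show ?thesis .
qed

end

text \<open>
  An operator on traceless matrices is extended to all matrices, where its trace can be read off from
  the matrix units.
\<close>

lemma op_trace_sl:
  fixes T :: "'a::field mat \<Rightarrow> 'a mat"
  assumes ex: "\<exists>B :: 'a mat set. finite B \<and> vectorspace.basis class_ring (sl n) B"
    and lin: "\<And>X. X \<in> carrier_mat n n \<Longrightarrow>
      lin_comb n (T X) (indices n) (\<lambda>p. X $$ p) (\<lambda>p. T (unit_mat n p))"
    and T: "\<And>X. X \<in> carrier_mat n n \<Longrightarrow> mat_trace (T X) = 0"
    and T': "\<And>X. X \<in> carrier (sl n) \<Longrightarrow> T' X = T X"
  shows "vectorspace.op_trace class_ring (sl n) T' = (\<Sum>p\<in>indices n. T (unit_mat n p) $$ p)"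
proof -
  interpret V: vectorspace class_ring "sl n :: ('a, 'a mat) module" by (rule vectorspace_sl)
  define B :: "'a mat set" where "B = (SOME B. finite B \<and> V.basis B)"
  have B: "finite B" "V.basis B" using someI_ex[OF ex] by (simp_all add: B_def)
  have "V.op_trace T' = (\<Sum>b\<in>B. V.coords B (T' b) b)"
    unfolding V.op_trace_def Let_def B_def[symmetric] by (simp add: class_ring_simps)
  also have "\<dots> = (\<Sum>b\<in>B. V.coords B (T b) b)"
    using basis_sl_carrier[OF B] T' by (intro sum.cong refl) (auto simp: subset_iff)
  also have "\<dots> = (\<Sum>p\<in>indices n. T (unit_mat n p) $$ p)"
    by (rule sum_coords_sl[OF B lin T])
  finally show ?thesis .
qed

section \<open>Dual bases of traceless matrices\<close>

lemma basis_sl_carrier_mat: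
  "dual_bases n B \<delta> \<Longrightarrow> \<alpha> \<in> B \<Longrightarrow> \<alpha> \<in> carrier_mat n n \<and> \<delta> \<alpha> \<in> carrier_mat n n"
  unfolding dual_bases_def using basis_sl_carrier by (fastforce simp: sl_simps)

text \<open>
  The basis consists of the off-diagonal units \<open>E\<^sub>i\<^sub>j\<close> and the differences \<open>E\<^sub>i\<^sub>i - E\<^sub>m\<^sub>m\<close> for a
  fixed index \<open>m\<close>; the dual elements are \<open>E\<^sub>j\<^sub>i\<close> and \<open>E\<^sub>i\<^sub>i - 1/n\<close>. Linear independence follows
  from duality.
\<close>

lemma dual_bases_exist:
  assumes "2 \<le> n"
  shows "\<exists>B (\<delta> :: 'a::field_char_0 mat \<Rightarrow> 'a mat). dual_bases n B \<delta>"
proof -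
  define m where "m = n - 1"
  define J where "J = indices n - {(m, m)}"
  define e :: "nat \<times> nat \<Rightarrow> 'a mat" where
    "e p = (if fst p = snd p then unit_mat n p - unit_mat n (m, m) else unit_mat n p)" for p
  define d :: "nat \<times> nat \<Rightarrow> 'a mat" where
    "d p = (if fst p = snd p then unit_mat n p - inverse (of_nat n) \<cdot>\<^sub>m 1\<^sub>m n else unit_mat n (prod.swap p))" for p
  have m: "m < n" using assms by (simp add: m_def)
  have n0: "(of_nat n :: 'a) \<noteq> 0" using assms by simp
  have unit_trace: "mat_trace (unit_mat n (i, j) :: 'a mat) = (if i = j then 1 else 0)" if "i < n" "j < n" for i j
  proof -
    have "mat_trace (unit_mat n (i, j) :: 'a mat) = (\<Sum>k<n. if k = i then (if i = j then 1 else 0) else 0)"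
      unfolding mat_trace_square[OF unit_mat_carrier] by (intro sum.cong refl) auto
    then show ?thesis using that by simp
  qed
  have e_sl: "e p \<in> carrier (sl n)" and d_sl: "d p \<in> carrier (sl n)" if "p \<in> J" for p
    using that m n0 by (auto simp: J_def e_def d_def sl_simps mat_trace_minus[of _ n] unit_trace minus_carrier_mat)
      (simp_all add: mat_trace_def)
  have e_trace: "mat_trace (e (i, j) * X) = X $$ (j, i) - (if i = j then X $$ (m, m) else 0)"
    if "X \<in> carrier_mat n n" "i < n" "j < n" for X i j
  proof -
    have *: "mat_trace (unit_mat n (k, l) * X) = X $$ (l, k)" if "k < n" "l < n" for k l
      using mat_trace_sandwich[of "1\<^sub>m n" n X k l] that \<open>X \<in> _\<close>
      by (simp add: left_mult_one_mat[of _ n n] right_mult_one_mat[of _ n n])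
    show ?thesis
    proof (cases "i = j")
      case True
      have "e (i, j) * X = unit_mat n (i, i) * X - unit_mat n (m, m) * X"
        unfolding e_def using True that by (simp add: minus_mult_distrib_mat[of _ n n _ _ n])
      then show ?thesis using True that m * by (simp add: mat_trace_minus[of _ n])
    qed (use that * in \<open>simp add: e_def\<close>)
  qed
  have duality: "mat_trace (e p * d q) = (if p = q then 1 else 0)" if "p \<in> J" "q \<in> J" for p q
  proof -
    obtain i j k l where pq: "p = (i, j)" "q = (k, l)" by (metis surj_pair)
    have "i < n" "j < n" "k < n" "l < n" "(i, j) \<noteq> (m, m)" "(k, l) \<noteq> (m, m)"
      using that by (auto simp: J_def pq)
    then show ?thesis
      using e_trace[of "d q" i j] d_sl[OF that(2)] m unfolding pq
      by (auto simp: sl_simps d_def)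
  qed
  have inj: "inj_on e J"
  proof (rule inj_onI)
    fix p q assume pq: "p \<in> J" "q \<in> J" "e p = e q"
    then have "(if p = q then 1 else 0) = (1 :: 'a)" using duality[of p q] duality[of q q] by simp
    then show "p = q" by (simp split: if_splits)
  qed
  define B where "B = e ` J"
  define \<delta> where "\<delta> \<alpha> = d (inv_into J e \<alpha>)" for \<alpha>
  have \<delta>: "\<delta> (e p) = d p" if "p \<in> J" for p
    unfolding \<delta>_def using inv_into_f_f[OF inj that] by simp
  have fin: "finite B" and B: "B \<subseteq> carrier (sl n)" using e_sl by (auto simp: B_def J_def)
  have expand: "lin_comb n v B a (\<lambda>b. b) \<longleftrightarrow> lin_comb n v J (\<lambda>p. a (e p)) e" for v a
    unfolding lin_comb_def B_def by (simp add: sum.reindex[OF inj])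
  have "\<exists>!a. a \<in> B \<rightarrow>\<^sub>E UNIV \<and> lin_comb n v B a (\<lambda>b. b)" if v: "v \<in> carrier (sl n)" for v
  proof (rule ex_ex1I)
    have v': "v \<in> carrier_mat n n" "(\<Sum>i<n. v $$ (i, i)) = 0"
      using v by (auto simp: sl_simps mat_trace_square)
    have "lin_comb n v J (\<lambda>p. v $$ p) e"
    proof (rule lin_combI)
      fix r s assume rs: "r < n" "s < n"
      have "(\<Sum>p\<in>J. v $$ p * e p $$ (r, s)) = (\<Sum>p\<in>indices n. v $$ p * e p $$ (r, s))"
        unfolding J_def using m rs by (intro sum.mono_neutral_left) (auto simp: e_def)
      also have "\<dots> = (\<Sum>p\<in>indices n. (if p = (r, s) then v $$ p else 0)
          - (if fst p = snd p then v $$ p else 0) * (if (r, s) = (m, m) then 1 else 0))"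
        using m rs by (intro sum.cong refl) (auto simp: e_def)
      also have "\<dots> = v $$ (r, s) - (\<Sum>p\<in>indices n. if fst p = snd p then v $$ p else 0) * (if (r, s) = (m, m) then 1 else 0)"
        using rs by (simp add: sum_subtractf sum_distrib_right)
      also have "(\<Sum>p\<in>indices n. if fst p = snd p then v $$ p else 0) = 0"
        using v'(2) by (simp add: sum_indices)
      finally show "v $$ (r, s) = (\<Sum>p\<in>J. v $$ p * e p $$ (r, s))" by simp
    qed (use v' e_sl in \<open>auto simp: sl_simps\<close>)
    then have "lin_comb n v B (\<lambda>b\<in>B. v $$ inv_into J e b) (\<lambda>b. b)"
      unfolding expand using inv_into_f_f[OF inj] by (simp add: lin_comb_def B_def)
    then show "\<exists>a. a \<in> B \<rightarrow>\<^sub>E UNIV \<and> lin_comb n v B a (\<lambda>b. b)"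
      by (intro exI[of _ "\<lambda>b\<in>B. v $$ inv_into J e b"]) simp
  next
    \<comment> \<open>pairing with the dual element recovers each coefficient\<close>
    have coeff: "a (e q) = mat_trace (v * d q)" if "lin_comb n v B a (\<lambda>b. b)" "q \<in> J" for a q
    proof -
      have "lin_comb n (v * d q) J (\<lambda>p. a (e p)) (\<lambda>p. e p * d q)"
        using that d_sl by (intro lin_comb_mult_right) (auto simp: expand sl_simps)
      then have "mat_trace (v * d q) = (\<Sum>p\<in>J. a (e p) * mat_trace (e p * d q))"
        by (rule mat_trace_lin_comb)
      also have "\<dots> = (\<Sum>p\<in>J. if p = q then a (e p) else 0)"
        using duality that(2) by (intro sum.cong refl) simp
      also have "\<dots> = a (e q)" using that(2) by (simp add: J_def)
      finally show ?thesis ..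
    qed
    fix a a'
    assume a: "a \<in> B \<rightarrow>\<^sub>E UNIV \<and> lin_comb n v B a (\<lambda>b. b)"
      and a': "a' \<in> B \<rightarrow>\<^sub>E UNIV \<and> lin_comb n v B a' (\<lambda>b. b)"
    show "a = a'"
    proof (rule PiE_ext[of _ B "\<lambda>_. UNIV"])
      fix b assume "b \<in> B"
      then obtain q where "q \<in> J" "b = e q" by (auto simp: B_def)
      then show "a b = a' b" using coeff[of a q] coeff[of a' q] a a' by simp
    qed (use a a' in auto)
  qed
  then have "vectorspace.basis class_ring (sl n) B"
    using basis_sl_iff[OF fin B] by blast
  moreover have "\<forall>\<alpha>\<in>B. \<forall>\<beta>\<in>B. mat_trace (\<alpha> * \<delta> \<beta>) = (if \<alpha> = \<beta> then 1 else 0)"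
    using duality \<delta> inj by (auto simp: B_def inj_on_eq_iff)
  moreover have "\<forall>\<alpha>\<in>B. \<delta> \<alpha> \<in> carrier (sl n)" using d_sl \<delta> by (auto simp: B_def)
  ultimately show ?thesis using fin unfolding dual_bases_def by blast
qed

section \<open>From traceless matrices to matrix units\<close>

lemma exists_basis_sl:
  "2 \<le> n \<Longrightarrow> \<exists>B :: 'a::field_char_0 mat set. finite B \<and> vectorspace.basis class_ring (sl n) B"
  using dual_bases_exist[where 'a = 'a, of n] unfolding dual_bases_def by blast

lemma mat_trace_unit:
  "p \<in> indices n \<Longrightarrow> mat_trace (unit_mat n p :: 'a::comm_ring_1 mat) = (if fst p = snd p then 1 else 0)"
proof -
  assume p: "p \<in> indices n"
  have "mat_trace (unit_mat n p :: 'a mat) = (\<Sum>k<n. if k = fst p then (if fst p = snd p then 1 else 0) else 0)"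
    unfolding mat_trace_square[OF unit_mat_carrier] by (intro sum.cong refl) (cases p, auto)
  then show ?thesis using p by auto
qed

definition traceless_part :: "nat \<Rightarrow> 'a::field mat \<Rightarrow> 'a mat" where
  "traceless_part n X = X - (mat_trace X / of_nat n) \<cdot>\<^sub>m 1\<^sub>m n"

lemma traceless_part_carrier: "X \<in> carrier_mat n n \<Longrightarrow> traceless_part n X \<in> carrier_mat n n"
  by (simp add: traceless_part_def minus_carrier_mat)

lemma traceless_part_index:
  "X \<in> carrier_mat n n \<Longrightarrow> r < n \<Longrightarrow> s < n \<Longrightarrow>
    traceless_part n X $$ (r, s) = X $$ (r, s) - (if r = s then mat_trace X / of_nat n else 0)"
  by (simp add: traceless_part_def)

lemma mat_trace_traceless_part:
  fixes X :: "'a::field_char_0 mat"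
  assumes "X \<in> carrier_mat n n" "2 \<le> n"
  shows "mat_trace (traceless_part n X) = 0"
proof -
  have "mat_trace (traceless_part n X) = (\<Sum>i<n. X $$ (i, i) - mat_trace X / of_nat n)"
    using assms(1) by (simp add: mat_trace_square[OF traceless_part_carrier[OF assms(1)]] traceless_part_index)
  then show ?thesis using assms by (simp add: sum_subtractf mat_trace_square)
qed

lemma ad_traceless_part:
  fixes X :: "'a::field mat"
  assumes "X \<in> carrier_mat n n" "y \<in> carrier_mat n n"
  shows "ad (traceless_part n X) y = ad X y"
proof -
  let ?k = "mat_trace X / of_nat n"
  have "traceless_part n X * y = X * y - ?k \<cdot>\<^sub>m y"
    using assms unfolding traceless_part_def
    by (subst minus_mult_distrib_mat[of _ n n _ _ n]) (simp_all add: left_mult_one_mat[of _ n n] mult_smult_assoc_mat[of _ n n _ n])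
  moreover have "y * traceless_part n X = y * X - ?k \<cdot>\<^sub>m y"
    using assms unfolding traceless_part_def
    by (subst mult_minus_distrib_mat[of _ n n _ n]) (simp_all add: right_mult_one_mat[of _ n n] mult_smult_distrib[of _ n n _ n])
  ultimately show ?thesis
    using assms unfolding ad_def by (intro eq_matI) (auto simp del: index_mult_mat(1))
qed

lemma lin_comb_traceless_part:
  fixes X :: "'a::field mat"
  assumes "X \<in> carrier_mat n n"
  shows "lin_comb n (traceless_part n X) (indices n) (\<lambda>p. X $$ p) (\<lambda>p. traceless_part n (unit_mat n p))"
proof -
  have "lin_comb n ((mat_trace X / of_nat n) \<cdot>\<^sub>m 1\<^sub>m n) (indices n) (\<lambda>p. X $$ p)
    (\<lambda>p. (mat_trace (unit_mat n p) / of_nat n) \<cdot>\<^sub>m 1\<^sub>m n)"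
    using mat_trace_lin_comb[OF lin_comb_units[OF assms]]
    by (intro lin_combI) (simp_all add: sum_divide_distrib)
  then show ?thesis
    unfolding traceless_part_def by (intro lin_comb_minus lin_comb_units assms)
qed

text \<open>
  For a nonempty list the operator has traceless values as it stands. The empty list gives the identity
  of \<open>sl n\<close>, which is extended to all matrices by the projection \<open>traceless_part\<close>; this costs \<open>1\<close>.
\<close>

lemma ad_trace_eq:
  fixes xs :: "'a::field_char_0 mat list"
  assumes "2 \<le> n" "set xs \<subseteq> carrier_mat n n"
  shows "ad_trace n xs = (\<Sum>p\<in>indices n. ad_prod xs (unit_mat n p) $$ p) - (if xs = [] then 1 else 0)"
proof (cases xs)
  case Nil
  have "ad_trace n xs = (\<Sum>p\<in>indices n. traceless_part n (unit_mat n p :: 'a mat) $$ p)"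
    unfolding ad_trace_def Nil foldr.simps id_apply
  proof (rule op_trace_sl[where T = "traceless_part n", OF exists_basis_sl[OF assms(1)]])
    show "X = traceless_part n X" if "X \<in> carrier (sl n)" for X :: "'a mat"
      using that by (intro eq_matI) (auto simp: traceless_part_index traceless_part_carrier sl_simps
          carrier_matD[OF traceless_part_carrier])
  next
    show "lin_comb n (traceless_part n X) (indices n) (\<lambda>p. X $$ p) (\<lambda>p. traceless_part n (unit_mat n p))"
      if "X \<in> carrier_mat n n" for X :: "'a mat"
      using that by (rule lin_comb_traceless_part)
    show "mat_trace (traceless_part n X) = 0" if "X \<in> carrier_mat n n" for X :: "'a mat"
      using that assms(1) by (rule mat_trace_traceless_part)
  qed
  also have "\<dots> = (\<Sum>p\<in>indices n. unit_mat n p $$ p - (if fst p = snd p then 1 / of_nat n else 0 :: 'a))"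
    using mat_trace_unit[where 'a = 'a] by (intro sum.cong refl) (auto simp: traceless_part_index)
  also have "\<dots> = (\<Sum>p\<in>indices n. unit_mat n p $$ p) - 1"
    using assms(1) by (simp add: sum_subtractf sum_indices)
  finally show ?thesis using Nil by simp
next
  case (Cons x ys)
  have "ad_trace n xs = (\<Sum>p\<in>indices n. ad_prod xs (unit_mat n p) $$ p)"
    unfolding ad_trace_def
  proof (rule op_trace_sl[OF exists_basis_sl[OF assms(1)]])
    fix X :: "'a mat" assume X: "X \<in> carrier_mat n n"
    show "lin_comb n (ad_prod xs X) (indices n) (\<lambda>p. X $$ p) (\<lambda>p. ad_prod xs (unit_mat n p))"
      by (intro lin_comb_ad_prod lin_comb_units X assms(2))
    show "mat_trace (ad_prod xs X) = 0"
      using ad_prod_carrier[of ys n X] X assms(2) Cons by (simp add: mat_trace_ad[where n = n])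
  qed (rule refl)
  then show ?thesis using Cons by simp
qed

text \<open>
  The expansion of \<open>X\<close> is required only under \<open>ad\<close>, that is, up to scalar matrices.
\<close>

lemma ad_trace_linear_at:
  fixes h :: "nat \<Rightarrow> 'a::field_char_0 mat"
  assumes "2 \<le> n" "distinct ps" "a \<in> set ps" "\<And>i. h i \<in> carrier_mat n n"
    and X: "X \<in> carrier_mat n n" and Z: "\<And>t. t \<in> I \<Longrightarrow> Z t \<in> carrier_mat n n"
    and lin: "\<And>y. y \<in> carrier_mat n n \<Longrightarrow> lin_comb n (ad X y) I c (\<lambda>t. ad (Z t) y)"
  shows "ad_trace n (map (h(a := X)) ps) = (\<Sum>t\<in>I. c t * ad_trace n (map (h(a := Z t)) ps))"
proof -
  obtain us vs where ps: "ps = us @ a # vs" using assms(3) by (auto dest: split_list)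
  have m: "map (h(a := M)) ps = map h us @ M # map h vs" for M using assms(2) ps by auto
  have tr: "ad_trace n (map (h(a := M)) ps) =
      (\<Sum>p\<in>indices n. ad_prod (map h us) (ad M (ad_prod (map h vs) (unit_mat n p))) $$ p)"
    if "M \<in> carrier_mat n n" for M
  proof -
    have "ad_prod (map h us @ M # map h vs) Y = ad_prod (map h us) (ad M (ad_prod (map h vs) Y))" for Y
      by (simp only: ad_prod_append) simp
    moreover have "set (map h us @ M # map h vs) \<subseteq> carrier_mat n n" using that assms(4) by auto
    ultimately show ?thesis unfolding m by (simp only: ad_trace_eq[OF assms(1)]) simp
  qed
  have "ad_prod (map h us) (ad X (ad_prod (map h vs) (unit_mat n p))) $$ p =
    (\<Sum>t\<in>I. c t * ad_prod (map h us) (ad (Z t) (ad_prod (map h vs) (unit_mat n p))) $$ p)"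
    if "p \<in> indices n" for p
  proof -
    have "lin_comb n (ad_prod (map h us) (ad X (ad_prod (map h vs) (unit_mat n p)))) I c
      (\<lambda>t. ad_prod (map h us) (ad (Z t) (ad_prod (map h vs) (unit_mat n p))))"
      using assms(4) by (intro lin_comb_ad_prod lin ad_prod_carrier) auto
    then show ?thesis using lin_combD(3) that by fastforce
  qed
  then have "ad_trace n (map (h(a := X)) ps) = (\<Sum>p\<in>indices n. \<Sum>t\<in>I.
      c t * ad_prod (map h us) (ad (Z t) (ad_prod (map h vs) (unit_mat n p))) $$ p)"
    unfolding tr[OF X] by (intro sum.cong refl)
  also have "\<dots> = (\<Sum>t\<in>I. \<Sum>p\<in>indices n.
      c t * ad_prod (map h us) (ad (Z t) (ad_prod (map h vs) (unit_mat n p))) $$ p)"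
    by (rule sum.swap)
  also have "\<dots> = (\<Sum>t\<in>I. c t * ad_trace n (map (h(a := Z t)) ps))"
    using tr[OF Z] by (intro sum.cong refl) (simp add: sum_distrib_left)
  finally show ?thesis .
qed

text \<open>
  Up to a scalar matrix, which \<open>ad\<close> does not see, a matrix unit is a combination of the basis; its
  coefficients are found by pairing with the dual basis.
\<close>

lemma ad_unit_mat_expand:
  fixes y :: "'a::field_char_0 mat"
  assumes "2 \<le> n" and B: "dual_bases n B \<delta>" and p: "p \<in> indices n" and y: "y \<in> carrier_mat n n"
  shows "lin_comb n (ad (unit_mat n p) y) B (\<lambda>t. \<delta> t $$ prod.swap p) (\<lambda>t. ad t y)"
proof -
  let ?X = "traceless_part n (unit_mat n p :: 'a mat)"
  have fin: "finite B" and basis: "vectorspace.basis class_ring (sl n) B"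
    and dual: "\<And>\<alpha> \<beta>. \<alpha> \<in> B \<Longrightarrow> \<beta> \<in> B \<Longrightarrow> mat_trace (\<alpha> * \<delta> \<beta>) = (if \<alpha> = \<beta> then 1 else 0)"
    and \<delta>: "\<And>\<beta>. \<beta> \<in> B \<Longrightarrow> \<delta> \<beta> \<in> carrier_mat n n \<and> mat_trace (\<delta> \<beta>) = 0"
    using B by (auto simp: dual_bases_def sl_simps)
  have "?X \<in> carrier (sl n)"
    by (simp add: sl_simps mat_trace_traceless_part[OF _ assms(1)] traceless_part_carrier)
  then obtain c where c: "lin_comb n ?X B c (\<lambda>b. b)"
    using coords_sl(1)[OF fin basis] by blast
  have "c \<beta> = \<delta> \<beta> $$ prod.swap p" if \<beta>: "\<beta> \<in> B" for \<beta>
  proof -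
    have "lin_comb n (?X * \<delta> \<beta>) B c (\<lambda>b. b * \<delta> \<beta>)"
      using c \<delta>[OF \<beta>] by (intro lin_comb_mult_right) auto
    then have "mat_trace (?X * \<delta> \<beta>) = (\<Sum>b\<in>B. c b * mat_trace (b * \<delta> \<beta>))"
      by (rule mat_trace_lin_comb)
    also have "\<dots> = (\<Sum>b\<in>B. if b = \<beta> then c b else 0)"
      using dual \<beta> by (intro sum.cong refl) simp
    also have "\<dots> = c \<beta>" using \<beta> fin by simp
    finally have "c \<beta> = mat_trace (?X * \<delta> \<beta>)" ..
    also have "?X * \<delta> \<beta> = unit_mat n p * \<delta> \<beta> - (mat_trace (unit_mat n p :: 'a mat) / of_nat n) \<cdot>\<^sub>m \<delta> \<beta>"
      using \<delta>[OF \<beta>] unfolding traceless_part_def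
      by (subst minus_mult_distrib_mat[of _ n n _ _ n]) (simp_all add: left_mult_one_mat[of _ n n] mult_smult_assoc_mat[of _ n n _ n])
    also have "mat_trace \<dots> = mat_trace (unit_mat n p * \<delta> \<beta>) - (mat_trace (unit_mat n p :: 'a mat) / of_nat n) * mat_trace (\<delta> \<beta>)"
      using \<delta>[OF \<beta>] by (subst mat_trace_minus[of _ n]) (simp_all add: mat_trace_smult[of _ n])
    also have "\<dots> = \<delta> \<beta> $$ prod.swap p"
      using \<delta>[OF \<beta>] p mat_trace_sandwich[of "1\<^sub>m n" n "\<delta> \<beta>" "fst p" "snd p"]
      by (auto simp: left_mult_one_mat[of _ n n] right_mult_one_mat[of _ n n])
    finally show ?thesis .
  qed
  then have "lin_comb n ?X B (\<lambda>t. \<delta> t $$ prod.swap p) (\<lambda>b. b)"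
    using c by (simp add: lin_comb_def)
  from lin_comb_ad_left[OF this y] show ?thesis
    by (simp add: ad_traceless_part y)
qed

text \<open>
  Expand the first factor of \<open>\<Sum> E\<^sub>i\<^sub>j \<otimes> E\<^sub>j\<^sub>i\<close> in the basis; the coefficients then collect
  the second factors to the dual elements.
\<close>

lemma contract_chord_dual_bases:
  fixes h :: "nat \<Rightarrow> 'a::field_char_0 mat"
  assumes "2 \<le> n" "dual_bases n B \<delta>" "distinct ps" "a \<in> set ps" "b \<in> set ps" "a \<noteq> b"
    and h: "\<And>i. h i \<in> carrier_mat n n"
  shows "(\<Sum>t\<in>B. ad_trace n (map (h(a := t, b := \<delta> t)) ps)) =
    (\<Sum>p\<in>indices n. ad_trace n (map (h(a := unit_mat n p, b := unit_mat n (prod.swap p))) ps))"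
proof -
  let ?F = "\<lambda>X Y. ad_trace n (map (h(a := X, b := Y)) ps)"
  have comm: "h(a := X, b := Y) = (h(b := Y))(a := X)" for X Y using assms(6) by auto
  note cB = basis_sl_carrier_mat[OF assms(2)]
  have "(\<Sum>p\<in>indices n. ?F (unit_mat n p) (unit_mat n (prod.swap p))) =
    (\<Sum>p\<in>indices n. \<Sum>t\<in>B. \<delta> t $$ prod.swap p * ?F t (unit_mat n (prod.swap p)))"
    unfolding comm using h cB
    by (intro sum.cong refl ad_trace_linear_at[OF assms(1,3,4)] ad_unit_mat_expand[OF assms(1,2)]) auto
  also have "\<dots> = (\<Sum>p\<in>indices n. \<Sum>t\<in>B. \<delta> t $$ p * ?F t (unit_mat n p))"
    by (rule sum_indices_swap)
  also have "\<dots> = (\<Sum>t\<in>B. \<Sum>p\<in>indices n. \<delta> t $$ p * ?F t (unit_mat n p))"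
    by (rule sum.swap)
  also have "\<dots> = (\<Sum>t\<in>B. ?F t (\<delta> t))"
    using h cB
    by (intro sum.cong refl ad_trace_linear_at[OF assms(1,3,5), symmetric] lin_comb_ad_left lin_comb_units) auto
  finally show ?thesis ..
qed

lemma chord_diagramD:
  assumes "chord_diagram C"
  shows "chord_set C" "\<Union>C = {1..2 * card C}"
proof -
  have p: "partition_on {1..2 * card C} C" and c: "\<forall>c\<in>C. card c = 2"
    using assms by (auto simp: chord_diagram_def)
  have "finite C"
    using finite_elements[OF _ p] by simp
  then show "chord_set C" "\<Union>C = {1..2 * card C}"
    using p c by (auto simp: chord_set_def partition_on_def)
qed

lemma contraction_eq_contract_units:
  fixes B :: "'a::field_char_0 mat set"
  assumes "2 \<le> n" "dual_bases n B \<delta>" "chord_diagram C"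
  shows "contraction n B \<delta> C = contract (indices n) (unit_mat n) (\<lambda>p. unit_mat n (prod.swap p)) C (\<lambda>_. 0\<^sub>m n n)
    (\<lambda>h. ad_trace n (map h [1..<2 * card C + 1]))"
proof -
  note C = chord_diagramD[OF assms(3)]
  have "contraction n B \<delta> C = contract B (\<lambda>t. t) \<delta> C (\<lambda>_. 0\<^sub>m n n) (\<lambda>h. ad_trace n (map h [1..<2 * card C + 1]))"
    unfolding contraction_def contract_def using C(2)
    by (intro sum.cong refl arg_cong[where f = "ad_trace n"] map_cong) (auto simp: place_def Let_def)
  also have "\<dots> = contract (indices n) (unit_mat n) (\<lambda>p. unit_mat n (prod.swap p)) C (\<lambda>_. 0\<^sub>m n n)
    (\<lambda>h. ad_trace n (map h [1..<2 * card C + 1]))"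
  proof (rule contract_change_tensor[OF C(1), where M = "carrier_mat n n"])
    fix c and h :: "nat \<Rightarrow> 'a mat"
    assume c: "c \<in> C" and h: "\<And>i. h i \<in> carrier_mat n n"
    have "card c = 2" using c C(1) by (auto simp: chord_set_def)
    note mm = chord_eq_Min_Max[OF this]
    have "Min c \<in> \<Union>C" "Max c \<in> \<Union>C" using c mm(1) by blast+
    then show "(\<Sum>t\<in>B. ad_trace n (map (h(Min c := t, Max c := \<delta> t)) [1..<2 * card C + 1])) =
      (\<Sum>p\<in>indices n. ad_trace n (map (h(Min c := unit_mat n p, Max c := unit_mat n (prod.swap p))) [1..<2 * card C + 1]))"
      using mm(2) C(2) h by (intro contract_chord_dual_bases[OF assms(1,2)]) auto
  qed (use basis_sl_carrier_mat[OF assms(2)] in auto)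
  finally show ?thesis .
qed

section \<open>The top coefficient\<close>

lemma contract_sum:
  "contract I u v C g (\<lambda>h. \<Sum>S\<in>A. c S * G S h) = (\<Sum>S\<in>A. (c S :: 'a::comm_ring_1) * contract I u v C g (G S))"
  unfolding contract_def by (subst sum.swap) (simp add: sum_distrib_left)

text \<open>
  The letters acting from the left and, in reverse order, those acting from the right.
\<close>

definition side_words :: "nat \<Rightarrow> nat set \<Rightarrow> nat list list" where
  "side_words m S = [filter (\<lambda>i. i \<in> S) [1..<m + 1], rev (filter (\<lambda>i. i \<notin> S) [1..<m + 1])]"

lemma side_words_properties:
  "distinct (concat (side_words m S))" "set (concat (side_words m S)) = {1..m}"
  "\<forall>w\<in>set (side_words m S). monotone_word w" "length (side_words m S) = 2"
  by (auto simp: side_words_def sorted_wrt_filter simp del: upt_Suc)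

lemma planar_side_words:
  assumes "S \<subseteq> {1..m}"
  shows "planar C (side_words m S) \<longleftrightarrow> (\<forall>c\<in>C. c \<subseteq> S \<or> c \<subseteq> {1..m} - S) \<and>
    pairwise_nonintersecting {c \<in> C. c \<subseteq> S} \<and> pairwise_nonintersecting {c \<in> C. c \<subseteq> {1..m} - S}"
proof -
  define u v where "u = filter (\<lambda>i. i \<in> S) [1..<m + 1]" and "v = rev (filter (\<lambda>i. i \<notin> S) [1..<m + 1])"
  have "set u = S" "set v = {1..m} - S"
    using assms by (auto simp: u_def v_def less_Suc_eq_le simp del: upt_Suc)
  moreover have "side_words m S = [u, v]" by (simp add: side_words_def u_def v_def)
  ultimately show ?thesis by (simp add: planar_def)
qed

text \<open>
  A splitting corresponds to the set of endpoints of its first family.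
\<close>

lemma card_splittings:
  assumes "chord_diagram C"
  shows "card (splittings C) = card {S \<in> Pow {1..2 * card C}. planar C (side_words (2 * card C) S)}"
proof -
  define A where "A = {1..2 * card C}"
  note C = chord_diagramD[OF assms]
  have UA: "\<Union>C = A" using C(2) by (simp add: A_def)
  have ne: "c \<noteq> {}" if "c \<in> C" for c using that C(1) by (auto simp: chord_set_def)
  have dj: "c \<inter> d = {}" if "c \<in> C" "d \<in> C" "c \<noteq> d" for c d
    using that C(1) unfolding chord_set_def disjoint_def by blast
  let ?g = "\<lambda>S. ({c \<in> C. c \<subseteq> S}, {c \<in> C. c \<subseteq> A - S})"
  have inv: "?g (\<Union>F) = (F, G)" and compl: "\<forall>c\<in>C. c \<subseteq> \<Union>F \<or> c \<subseteq> A - \<Union>F"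
    if "F \<union> G = C" "F \<inter> G = {}" for F G
  proof -
    have F: "c \<subseteq> \<Union>F \<longleftrightarrow> c \<in> F" if c: "c \<in> C" for c
    proof
      assume "c \<subseteq> \<Union>F"
      then obtain x d where "x \<in> c" "x \<in> d" "d \<in> F" using ne[OF c] by blast
      moreover from this have "d \<in> C" using \<open>F \<union> G = C\<close> by blast
      ultimately show "c \<in> F" using dj[OF c, of d] by blast
    qed blast
    have G: "c \<subseteq> A - \<Union>F \<longleftrightarrow> c \<in> G" if c: "c \<in> C" for c
    proof
      assume "c \<subseteq> A - \<Union>F"
      then have "\<not> c \<subseteq> \<Union>F" using ne[OF c] by blast
      then show "c \<in> G" using F[OF c] c \<open>F \<union> G = C\<close> by blast
    next
      assume "c \<in> G"
      then have "d \<in> F \<Longrightarrow> c \<inter> d = {}" for d using that dj[OF c, of d] \<open>F \<inter> G = {}\<close> \<open>F \<union> G = C\<close> by blast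
      then show "c \<subseteq> A - \<Union>F" using c UA by blast
    qed
    show "?g (\<Union>F) = (F, G)" using F G \<open>F \<union> G = C\<close> by blast
    show "\<forall>c\<in>C. c \<subseteq> \<Union>F \<or> c \<subseteq> A - \<Union>F" using F G \<open>F \<union> G = C\<close> by blast
  qed
  have "bij_betw (\<lambda>(F, G). \<Union>F) (splittings C) {S \<in> Pow A. planar C (side_words (2 * card C) S)}"
  proof (rule bij_betwI[where g = ?g])
    show "(\<lambda>(F, G). \<Union>F) \<in> splittings C \<rightarrow> {S \<in> Pow A. planar C (side_words (2 * card C) S)}"
    proof (clarify)
      fix F G assume FG: "(F, G) \<in> splittings C"
      then have *: "F \<union> G = C" "F \<inter> G = {}" "pairwise_nonintersecting F" "pairwise_nonintersecting G"
        by (auto simp: splittings_def)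
      have "\<Union>F \<subseteq> A" using *(1) UA by blast
      moreover from this have "planar C (side_words (2 * card C) (\<Union>F))"
        using planar_side_words[of "\<Union>F" "2 * card C" C] compl[OF *(1,2)] inv[OF *(1,2)] *(3,4)
        by (simp add: A_def)
      ultimately show "\<Union>F \<in> Pow A \<and> planar C (side_words (2 * card C) (\<Union>F))" by blast
    qed
    show "?g \<in> {S \<in> Pow A. planar C (side_words (2 * card C) S)} \<rightarrow> splittings C"
    proof
      fix S assume "S \<in> {S \<in> Pow A. planar C (side_words (2 * card C) S)}"
      then have S: "S \<subseteq> A" "\<forall>c\<in>C. c \<subseteq> S \<or> c \<subseteq> A - S"
        "pairwise_nonintersecting {c \<in> C. c \<subseteq> S}" "pairwise_nonintersecting {c \<in> C. c \<subseteq> A - S}"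
        using planar_side_words[of S "2 * card C" C] by (auto simp: A_def)
      moreover have "{c \<in> C. c \<subseteq> S} \<inter> {c \<in> C. c \<subseteq> A - S} = {}" using ne by blast
      ultimately show "?g S \<in> splittings C" unfolding splittings_def by blast
    qed
    show "?g (case x of (F, G) \<Rightarrow> \<Union>F) = x" if "x \<in> splittings C" for x
    proof -
      obtain F G where x: "x = (F, G)" by (cases x)
      then have "F \<union> G = C" "F \<inter> G = {}" using that by (simp_all add: splittings_def)
      then show ?thesis using inv x by simp
    qed
    show "(case ?g S of (F, G) \<Rightarrow> \<Union>F) = S"
      if "S \<in> {S \<in> Pow A. planar C (side_words (2 * card C) S)}" for S
    proof -
      have S: "S \<subseteq> A" "\<forall>c\<in>C. c \<subseteq> S \<or> c \<subseteq> A - S"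
        using that planar_side_words[of S "2 * card C" C] by (auto simp: A_def)
      have "S \<subseteq> \<Union>{c \<in> C. c \<subseteq> S}"
      proof
        fix x assume x: "x \<in> S"
        then obtain c where c: "c \<in> C" "x \<in> c" using S(1) UA by blast
        then have "c \<subseteq> S" using S(2) x by blast
        then show "x \<in> \<Union>{c \<in> C. c \<subseteq> S}" using c by blast
      qed
      then show ?thesis by auto
    qed
  qed
  then show ?thesis unfolding A_def by (rule bij_betw_same_card)
qed

text \<open>
  The complement is a union of disjoint pairs. Hence all terms of top degree have the sign \<open>+\<close>.
\<close>

lemma even_card_complement_if_planar:
  assumes "chord_diagram C" "S \<subseteq> {1..2 * card C}" "planar C (side_words (2 * card C) S)"
  shows "even (card ({1..2 * card C} - S))"
proof -
  note C = chord_diagramD[OF assms(1)]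
  let ?G = "{c \<in> C. c \<subseteq> {1..2 * card C} - S}"
  have "\<forall>c\<in>C. c \<subseteq> S \<or> c \<subseteq> {1..2 * card C} - S"
    using assms(3) planar_side_words[OF assms(2)] by blast
  then have U: "{1..2 * card C} - S = \<Union>?G" using C(2) by blast
  have "card (\<Union>?G) = sum card ?G"
    using C(1) by (intro card_Union_disjoint)
      (auto simp: chord_set_def pairwise_def intro: card_ge_0_finite)
  also have "\<dots> = 2 * card ?G" using C(1) by (simp add: chord_set_def)
  finally have "even (card (\<Union>?G))" by simp
  then show ?thesis by (subst U)
qed

text \<open>
  Two such polynomials agree at all integers \<open>n \<ge> 2\<close>, since at each of them a pair of dual bases
  exists to compare them.
\<close>

lemma represents_U_unique:
  fixes p q :: "'a::field_char_0 poly"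
  assumes "represents_U C p" "represents_U C q"
  shows "p = q"
proof (rule ccontr)
  assume "p \<noteq> q"
  then have "finite {x. poly (p - q) x = 0}" by (intro poly_roots_finite) simp
  moreover have "of_nat ` {2..} \<subseteq> {x. poly (p - q) x = 0}"
  proof clarify
    fix n :: nat assume "2 \<le> n"
    moreover from this obtain B and \<delta> :: "'a mat \<Rightarrow> 'a mat" where "dual_bases n B \<delta>" using dual_bases_exist by blast
    ultimately show "poly (p - q) (of_nat n) = 0"
      using assms unfolding represents_U_def by simp
  qed
  ultimately have "finite (of_nat ` {2::nat..} :: 'a set)" by (rule rev_finite_subset)
  then have "finite {2::nat..}" by (rule finite_imageD) (simp add: inj_on_def)
  then show False using infinite_Ici by blast
qed

theorem U_polynomial:
  assumes "chord_diagram C"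
  shows "\<exists>p :: 'a::field_char_0 poly. represents_U C p \<and> degree p \<le> card C + 2 \<and>
    coeff p (card C + 2) = of_nat (card (splittings C))"
proof -
  define k where "k = card C"
  note C = chord_diagramD[OF assms]
  let ?A = "{1..2 * k}"
  let ?T = "\<lambda>n (F :: (nat \<Rightarrow> 'a mat) \<Rightarrow> 'a).
    contract (indices n) (unit_mat n) (\<lambda>p. unit_mat n (prod.swap p)) C (\<lambda>_. 0\<^sub>m n n) F"
  have "\<exists>f \<le> k + 2. (f = k + 2 \<longleftrightarrow> planar C (side_words (2 * k) S)) \<and>
    (\<forall>n. ?T n (word_traces n (side_words (2 * k) S)) = of_nat n ^ f)" for S
    using contract_word_traces[OF C(1), where 'a = 'a, of "side_words (2 * k) S"]
      side_words_properties[of "2 * k" S] C(2) unfolding k_def by auto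
  then obtain f where f: "\<And>S. f S \<le> k + 2" "\<And>S. f S = k + 2 \<longleftrightarrow> planar C (side_words (2 * k) S)"
    "\<And>S n. ?T n (word_traces n (side_words (2 * k) S)) = of_nat n ^ f S"
    by metis
  define p :: "'a poly" where
    "p = (\<Sum>S\<in>Pow ?A. monom ((- 1) ^ card (?A - S)) (f S)) - (if k = 0 then 1 else 0)"
  have "poly p (of_nat n) = contraction n B \<delta> C" if n: "2 \<le> n" and B: "dual_bases n B \<delta>" for n B \<delta>
  proof -
    let ?G = "\<lambda>h. \<Sum>S\<in>Pow ?A. (- 1) ^ card (?A - S) * word_traces n (side_words (2 * k) S) h"
    have ad: "ad_trace n (map h [1..<2 * k + 1]) = ?G h - (if k = 0 then 1 else 0)"
      if "\<And>i. i \<in> ?A \<Longrightarrow> h i \<in> carrier_mat n n" for h :: "nat \<Rightarrow> 'a mat"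
    proof -
      have "set [1..<2 * k + 1] = ?A" by auto
      then show ?thesis
        using sum_diagonal_ad_prod[of "[1..<2 * k + 1]" h n] that
        by (subst ad_trace_eq[OF n]) (auto simp: side_words_def simp del: upt_Suc)
    qed
    have "contraction n B \<delta> C = ?T n (\<lambda>h. ad_trace n (map h [1..<2 * k + 1]))"
      using contraction_eq_contract_units[OF n B assms] by (simp only: k_def)
    also have "\<dots> = ?T n (\<lambda>h. ?G h - (if k = 0 then 1 else 0))"
    proof (rule contract_cong[OF C(1), where M = "carrier_mat n n"])
      fix h :: "nat \<Rightarrow> 'a mat"
      assume "\<And>i. i \<in> \<Union>C \<Longrightarrow> h i \<in> carrier_mat n n"
      then show "ad_trace n (map h [1..<2 * k + 1]) = ?G h - (if k = 0 then 1 else 0)"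
        unfolding C(2) by (intro ad) (simp add: k_def)
    qed simp_all
    also have "\<dots> = ?T n ?G - (if k = 0 then 1 else 0)"
    proof (cases "k = 0")
      case True
      then have "C = {}" using C(1) by (simp add: k_def chord_set_def)
      then show ?thesis by (simp add: contract_empty)
    qed simp
    also have "\<dots> = poly p (of_nat n)"
      by (simp add: contract_sum f(3) p_def poly_sum poly_monom)
    finally show ?thesis ..
  qed
  then have "represents_U C p" unfolding represents_U_def by blast
  moreover have "degree p \<le> card C + 2"
    unfolding p_def k_def[symmetric] using f(1)
    by (intro degree_diff_le degree_sum_le) (auto intro: order_trans[OF degree_monom_le])
  moreover have "coeff p (card C + 2) = of_nat (card (splittings C))"
  proof -
    have "coeff p (k + 2) = (\<Sum>S\<in>Pow ?A. if f S = k + 2 then (- 1) ^ card (?A - S) else 0)"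
      by (simp add: p_def coeff_sum del: One_nat_def)
    also have "\<dots> = (\<Sum>S\<in>Pow ?A. if planar C (side_words (2 * k) S) then 1 else 0)"
    proof (intro sum.cong refl)
      fix S assume "S \<in> Pow ?A"
      then show "(if f S = k + 2 then (- 1) ^ card (?A - S) else 0 :: 'a)
        = (if planar C (side_words (2 * k) S) then 1 else 0)"
        unfolding f(2) using even_card_complement_if_planar[OF assms, of S] by (auto simp: k_def)
    qed
    also have "\<dots> = of_nat (card {S \<in> Pow ?A. planar C (side_words (2 * k) S)})"
      by (subst sum.inter_filter[symmetric]) simp_all
    finally show ?thesis using card_splittings[OF assms] by (simp add: k_def)
  qed
  ultimately show ?thesis by blast
qed

lemma d_diagram_iff_card_splittings:
  assumes "chord_diagram C"
  shows "d_diagram C \<longleftrightarrow> card (splittings C) \<noteq> 0"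
proof -
  have "finite C" using chord_diagramD(1)[OF assms] by (simp add: chord_set_def)
  moreover have "splittings C \<subseteq> Pow C \<times> Pow C" unfolding splittings_def by blast
  ultimately have "finite (splittings C)" by (simp add: finite_subset)
  then have "card (splittings C) \<noteq> 0 \<longleftrightarrow> splittings C \<noteq> {}" by simp
  also have "\<dots> \<longleftrightarrow> (\<exists>F G. (F, G) \<in> splittings C)" by auto
  finally show ?thesis using assms unfolding d_diagram_def by blast
qed

theorem theorem4:
  fixes C :: "nat set set" and k :: nat
  assumes "chord_diagram C" and "card C = k"
  shows "represents_U C (U_poly C :: 'a::field_char_0 poly)
    \<and> (degree (U_poly C :: 'a poly) = k + 2 \<longleftrightarrow> d_diagram C)
    \<and> coeff (U_poly C :: 'a poly) (k + 2) = of_nat (card (splittings C))"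
proof -
  obtain p :: "'a poly" where p: "represents_U C p" "degree p \<le> k + 2"
    "coeff p (k + 2) = of_nat (card (splittings C))"
    using U_polynomial[OF assms(1), where 'a = 'a] unfolding assms(2) by (elim exE conjE)
  have U: "U_poly C = p"
    unfolding U_poly_def
    by (rule the_equality) (rule p(1), rule represents_U_unique[OF _ p(1)])
  have "degree p = k + 2 \<longleftrightarrow> coeff p (k + 2) \<noteq> 0"
  proof
    assume d: "degree p = k + 2"
    then have "p \<noteq> 0" by auto
    then show "coeff p (k + 2) \<noteq> 0" using leading_coeff_neq_0[of p] d by simp
  qed (use p(2) le_degree[of p "k + 2"] in simp)
  also have "\<dots> \<longleftrightarrow> d_diagram C"
    unfolding p(3) using d_diagram_iff_card_splittings[OF assms(1)] by simp
  finally show ?thesis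
    unfolding U using p(1,3) by blast
qed

end
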